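(* For every generalised Büchi automaton and every generalised coBüchi automaton $\mathcal{A}$: $\mathcal{A}$ is history-deterministic if and only if Eve wins the $G_2$ game on $\mathcal{A}$.
   Context: An automaton is a tuple $\mathcal{A}=(Q,\Sigma,q_{\mathrm{init}},\Delta,\Gamma,\mathrm{col},W)$ with finite state set, finite input alphabet $\Sigma$, initial state, transitions $\Delta\subseteq Q\times\Sigma\times Q$, output alphabet $\Gamma$, labelling $\mathrm{col}:\Delta\to\Gamma$, acceptance condition $W\subseteq\Gamma^\omega$. A run on $w=a_1a_2\cdots$ is a sequence $(q_0,a_1,q_1)(q_1,a_2,q_2)\cdots$ of transitions with $q_0=q_{\mathrm{init}}$, accepting if its label sequence is in $W$; $\mathcal{L}(\mathcal{A})$ is the set of words with an accepting run. With finite colour set $C$ and $\Gamma=2^C$: generalised Büchi means $W=\{x : \text{every } c\in C \text{ occurs in infinitely many letters of } x\}$; generalised coBüchi means $W=\{x : \text{some } c\in C \text{ occurs in only finitely many letters of } x\}$. A resolver is a map $\sigma:\Sigma^+\to\Delta$ such that for every $w=a_0a_1\cdots$, $\sigma(a_0)\sigma(a_0a_1)\cdots$ is a run on $w$, accepting whenever $w\in\mathcal{L}(\mathcal{A})$; history-deterministic means a resolver exists. The $G_2$ game on $\mathcal{A}$ is played between Eve and Adam on positions $Q^3$ starting at $(q_{\mathrm{init}},q_{\mathrm{init}},q_{\mathrm{init}})$; in each round from $(p,q_1,q_2)$, Adam chooses a letter $a\in\Sigma$, Eve chooses a transition $(p,a,p')\in\Delta$, Adam chooses transitions $(q_1,a,q_1'),(q_2,a,q_2')\in\Delta$,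 and the game moves to $(p',q_1',q_2')$. Eve wins a play if the run in the first component is accepting, or both runs in the second and third components are rejecting; Eve wins the game if she has a strategy winning all plays. *)

theory Defs
  imports Main
begin

type_synonym ('q,'a) trans = "'q \<times> 'a \<times> 'q"

record ('q,'a,'c) automaton =
  states   :: "'q set"
  alphabet :: "'a set"
  init     :: 'q
  delta    :: "('q,'a) trans set"
  colours  :: "'c set"
  col      :: "('q,'a) trans \<Rightarrow> 'c set"

definition wf_automaton :: "('q,'a,'c) automaton \<Rightarrow> bool" where
  "wf_automaton A \<longleftrightarrow> finite (states A) \<and> finite (alphabet A) \<and> init A \<in> states A
     \<and> delta A \<subseteq> states A \<times> alphabet A \<times> states A \<and> finite (colours A)
     \<and> (\<forall>t\<in>delta A. col A t \<subseteq> colours A)"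

definition gen_buchi :: "'c set \<Rightarrow> (nat \<Rightarrow> 'c set) \<Rightarrow> bool" where
  "gen_buchi C x \<longleftrightarrow> (\<forall>c\<in>C. \<exists>\<^sub>\<infinity>i. c \<in> x i)"

definition gen_cobuchi :: "'c set \<Rightarrow> (nat \<Rightarrow> 'c set) \<Rightarrow> bool" where
  "gen_cobuchi C x \<longleftrightarrow> (\<exists>c\<in>C. finite {i. c \<in> x i})"

definition src :: "('q,'a) trans \<Rightarrow> 'q" where "src t = fst t"
definition lbl :: "('q,'a) trans \<Rightarrow> 'a" where "lbl t = fst (snd t)"
definition tgt :: "('q,'a) trans \<Rightarrow> 'q" where "tgt t = snd (snd t)"

definition is_word :: "('q,'a,'c) automaton \<Rightarrow> (nat \<Rightarrow> 'a) \<Rightarrow> bool" where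
  "is_word A w \<longleftrightarrow> (\<forall>i. w i \<in> alphabet A)"

definition run_prefix :: "('q,'a,'c) automaton \<Rightarrow> (nat \<Rightarrow> 'a) \<Rightarrow> (nat \<Rightarrow> ('q,'a) trans) \<Rightarrow> nat \<Rightarrow> bool" where
  "run_prefix A w r n \<longleftrightarrow> (\<forall>i<n. r i \<in> delta A \<and> lbl (r i) = w i
      \<and> src (r i) = (if i = 0 then init A else tgt (r (i - 1))))"

definition is_run :: "('q,'a,'c) automaton \<Rightarrow> (nat \<Rightarrow> 'a) \<Rightarrow> (nat \<Rightarrow> ('q,'a) trans) \<Rightarrow> bool" where
  "is_run A w r \<longleftrightarrow> (\<forall>n. run_prefix A w r n)"

definition accepting :: "('q,'a,'c) automaton \<Rightarrow> ((nat \<Rightarrow> 'c set) \<Rightarrow> bool) \<Rightarrow> (nat \<Rightarrow> ('q,'a) trans) \<Rightarrow> bool" where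
  "accepting A W r \<longleftrightarrow> W (\<lambda>i. col A (r i))"

definition lang :: "('q,'a,'c) automaton \<Rightarrow> ((nat \<Rightarrow> 'c set) \<Rightarrow> bool) \<Rightarrow> (nat \<Rightarrow> 'a) set" where
  "lang A W = {w. is_word A w \<and> (\<exists>r. is_run A w r \<and> accepting A W r)}"

definition pref :: "(nat \<Rightarrow> 'a) \<Rightarrow> nat \<Rightarrow> 'a list" where
  "pref w n = map w [0..<n]"

definition is_resolver :: "('q,'a,'c) automaton \<Rightarrow> ((nat \<Rightarrow> 'c set) \<Rightarrow> bool)
    \<Rightarrow> ('a list \<Rightarrow> ('q,'a) trans) \<Rightarrow> bool" where
  "is_resolver A W \<sigma> \<longleftrightarrow> (\<forall>w. is_word A w \<longrightarrow>
      is_run A w (\<lambda>i. \<sigma> (pref w (Suc i)))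
      \<and> (w \<in> lang A W \<longrightarrow> accepting A W (\<lambda>i. \<sigma> (pref w (Suc i)))))"

definition history_deterministic :: "('q,'a,'c) automaton \<Rightarrow> ((nat \<Rightarrow> 'c set) \<Rightarrow> bool) \<Rightarrow> bool" where
  "history_deterministic A W \<longleftrightarrow> (\<exists>\<sigma>. is_resolver A W \<sigma>)"

text \<open>G2 game. An Eve strategy sees the letters a_0..a_i chosen by Adam so far and
  Adam's pairs of transitions from rounds 0..i-1 (her own earlier moves are determined
  by the strategy) and returns her transition for round i.
  Quantifying over all Adam move sequences covers all Adam strategies.\<close>
definition eve_play :: "('a list \<Rightarrow> (('q,'a) trans \<times> ('q,'a) trans) list \<Rightarrow> ('q,'a) trans)
    \<Rightarrow> (nat \<Rightarrow> 'a) \<Rightarrow> (nat \<Rightarrow> ('q,'a) trans) \<Rightarrow> (nat \<Rightarrow> ('q,'a) trans) \<Rightarrow> nat \<Rightarrow> ('q,'a) trans" where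
  "eve_play \<tau> w t1 t2 i = \<tau> (pref w (Suc i)) (map (\<lambda>j. (t1 j, t2 j)) [0..<i])"

text \<open>Eve wins with tau if (1) she always makes a legal move as long as Adam has made only
  legal moves (a player unable to move loses), and (2) in every infinite play
  her run is accepting or both of Adam's runs are rejecting.\<close>
definition eve_wins_G2 :: "('q,'a,'c) automaton \<Rightarrow> ((nat \<Rightarrow> 'c set) \<Rightarrow> bool) \<Rightarrow> bool" where
  "eve_wins_G2 A W \<longleftrightarrow> (\<exists>\<tau>.
     (\<forall>w t1 t2 n. is_word A w \<longrightarrow> run_prefix A w t1 n \<longrightarrow> run_prefix A w t2 n \<longrightarrow>
        run_prefix A w (eve_play \<tau> w t1 t2) (Suc n))
   \<and> (\<forall>w t1 t2. is_word A w \<longrightarrow> is_run A w t1 \<longrightarrow> is_run A w t2 \<longrightarrow>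
        accepting A W (eve_play \<tau> w t1 t2)
        \<or> (\<not> accepting A W t1 \<and> \<not> accepting A W t2)))"

end

theory Submission
  imports Defs "HOL-Library.Infinite_Set"
begin

text \<open>
  A resolver wins \<open>G2\<close> by ignoring Adam's tokens. For the converse, say that \<open>p\<close> dominates \<open>q\<close> if
  Eve, moving from \<open>p\<close>, beats one token of Adam that starts in \<open>q\<close>. Composing strategies shows that
  after every finite word some reachable state dominates all reachable states, and such a state
  always has such a successor. Playing the two-token strategy against an accepting run and
  a run through dominating states yields an accepting run through dominating states. Hence
  one may pass to an arena in which all states reached by the same word dominate each other.

  In a one-token game Eve moves before Adam's token, so a chain of \<open>K\<close> copies of her strategy, each
  playing against the next, beats a token that moves with lookahead \<open>K\<close>.

  For generalised Buchi conditions, call a word an event if every state of the current class has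
  a run on it that sees all colours. If Eve cannot force the colour \<open>c\<close> before a bounded number of
  events, then Adam can avoid \<open>c\<close> forever while producing events within bounded time, and a token
  with lookahead that takes the promised runs beats Eve. So Eve obtains every colour in turn.

  For generalised coBuchi conditions, a run that eventually avoids \<open>c\<close> eventually stays in a strongly
  connected component of the transitions without \<open>c\<close>. Lookahead shows that for every state \<open>q\<close>
  some equivalent state can avoid some colour as long as \<open>q\<close> has a run inside its component.
  Eve chases the virtual run so obtained for the oldest start of a run that is still alive.
\<close>

section \<open>Runs and causal strategies\<close>

definition st :: "'s \<Rightarrow> (nat \<Rightarrow> ('s,'a) trans) \<Rightarrow> nat \<Rightarrow> 's" where
  "st p r i = (if i = 0 then p else tgt (r (i - 1)))"

definition runp :: "('s,'a) trans set \<Rightarrow> 's \<Rightarrow> (nat \<Rightarrow> 'a) \<Rightarrow> (nat \<Rightarrow> ('s,'a) trans) \<Rightarrow> nat \<Rightarrow> bool" where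
  "runp D p w r n \<longleftrightarrow> (\<forall>i<n. r i \<in> D \<and> lbl (r i) = w i \<and> src (r i) = st p r i)"

definition runf :: "('s,'a) trans set \<Rightarrow> 's \<Rightarrow> (nat \<Rightarrow> 'a) \<Rightarrow> (nat \<Rightarrow> ('s,'a) trans) \<Rightarrow> bool" where
  "runf D p w r \<longleftrightarrow> (\<forall>i. r i \<in> D \<and> lbl (r i) = w i \<and> src (r i) = st p r i)"

definition conc :: "nat \<Rightarrow> (nat \<Rightarrow> 'b) \<Rightarrow> (nat \<Rightarrow> 'b) \<Rightarrow> nat \<Rightarrow> 'b" where
  "conc n f g j = (if j < n then f j else g (j - n))"

text \<open>\<open>F\<close> maps a word and Adam's token to Eve's run. Delay 1 is the order of the
  one-token game, where Eve moves before the token; with delay \<open>K\<close>, Adam may fix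
  transition \<open>j\<close> after Eve's move in round \<open>j + K - 1\<close>.\<close>

definition delayed :: "nat \<Rightarrow> ((nat \<Rightarrow> 'a) \<Rightarrow> (nat \<Rightarrow> 'b) \<Rightarrow> nat \<Rightarrow> 'd) \<Rightarrow> bool" where
  "delayed K F \<longleftrightarrow> (\<forall>w w' t t' i. (\<forall>j\<le>i. w j = w' j) \<longrightarrow> (\<forall>j. j + K \<le> i \<longrightarrow> t j = t' j) \<longrightarrow> F w t i = F w' t' i)"

definition wcausal :: "((nat \<Rightarrow> 'a) \<Rightarrow> nat \<Rightarrow> 'd) \<Rightarrow> bool" where
  "wcausal R \<longleftrightarrow> (\<forall>w w' i. (\<forall>j\<le>i. w j = w' j) \<longrightarrow> R w i = R w' i)"

definition wordin :: "'a set \<Rightarrow> (nat \<Rightarrow> 'a) \<Rightarrow> bool" where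
  "wordin Sg w \<longleftrightarrow> (\<forall>i. w i \<in> Sg)"

lemma trans_simps [simp]: "src (p, a, q) = p" "lbl (p, a, q) = a" "tgt (p, a, q) = q"
  by (simp_all add: src_def lbl_def tgt_def)

lemma trans_collapse [simp]: "(src t, lbl t, tgt t) = t"
  by (cases t) auto

lemma st_0 [simp]: "st p r 0 = p"
  by (simp add: st_def)

lemma st_Suc [simp]: "st p r (Suc i) = tgt (r i)"
  by (simp add: st_def)

lemma st_cong: "(\<And>j. j < n \<Longrightarrow> r j = r' j) \<Longrightarrow> st p r n = st p r' n"
  by (cases n) auto

lemma runf_iff: "runf D p w r \<longleftrightarrow> (\<forall>n. runp D p w r n)"
  by (auto simp: runf_def runp_def)

lemma runp_mono: "runp D p w r n \<Longrightarrow> m \<le> n \<Longrightarrow> runp D p w r m"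
  by (auto simp: runp_def)

lemma runp_0 [simp]: "runp D p w r 0"
  by (simp add: runp_def)

lemma runp_Suc: "runp D p w r (Suc n) \<longleftrightarrow> runp D p w r n \<and> r n \<in> D \<and> lbl (r n) = w n \<and> src (r n) = st p r n"
  by (auto simp: runp_def less_Suc_eq)

lemma runp_cong:
  assumes "\<And>j. j < n \<Longrightarrow> r j = r' j" "\<And>j. j < n \<Longrightarrow> w j = w' j"
  shows "runp D p w r n \<longleftrightarrow> runp D p w' r' n"
proof -
  have "st p r i = st p r' i" if "i < n" for i
    using that assms by (intro st_cong) auto
  then show ?thesis using assms by (auto simp: runp_def)
qed

lemma runf_shift:
  assumes "runf D p w r"
  shows "runf D (st p r n) (\<lambda>i. w (n + i)) (\<lambda>i. r (n + i))"
  using assms unfolding runf_def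
  by (auto simp: st_def)

lemma conc_less [simp]: "j < n \<Longrightarrow> conc n f g j = f j"
  by (simp add: conc_def)

lemma conc_add [simp]: "conc n f g (n + i) = g i"
  by (simp add: conc_def)

lemma st_conc: "st p (conc n r r') (n + m) = st (st p r n) r' m"
proof (cases m)
  case 0
  then show ?thesis by simp (intro st_cong, auto)
qed simp

lemma runf_conc:
  assumes "runp D p w r n" "runf D (st p r n) w' r'"
  shows "runf D p (conc n w w') (conc n r r')"
  unfolding runf_def
proof
  fix i
  show "conc n r r' i \<in> D \<and> lbl (conc n r r' i) = conc n w w' i \<and> src (conc n r r' i) = st p (conc n r r') i"
  proof (cases "i < n")
    case True
    then have "st p (conc n r r') i = st p r i" by (intro st_cong) auto
    with True assms(1) show ?thesis by (auto simp: runp_def)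
  next
    case False
    then obtain k where i: "i = n + k" using le_Suc_ex by (metis not_less)
    show ?thesis using assms(2) unfolding i runf_def by (simp add: st_conc)
  qed
qed

lemma wordin_conc: "wordin S w \<Longrightarrow> wordin S w' \<Longrightarrow> wordin S (conc n w w')"
  by (auto simp: wordin_def conc_def)

lemma wordin_shift: "wordin S w \<Longrightarrow> wordin S (\<lambda>i. w (n + i))"
  by (auto simp: wordin_def)

lemma delayedD:
  "delayed K F \<Longrightarrow> (\<And>j. j \<le> i \<Longrightarrow> w j = w' j) \<Longrightarrow> (\<And>j. j + K \<le> i \<Longrightarrow> t j = t' j) \<Longrightarrow> F w t i = F w' t' i"
  unfolding delayed_def by blast

lemma wcausalD: "wcausal R \<Longrightarrow> (\<And>j. j \<le> i \<Longrightarrow> w j = w' j) \<Longrightarrow> R w i = R w' i"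
  unfolding wcausal_def by blast

text \<open>The run of \<open>G\<close> is the token of \<open>F\<close>: step \<open>i\<close> of
  \<open>F\<close> reads \<open>G\<close> up to step \<open>i - K\<close>, which in turn reads the
  token up to \<open>i - K - M\<close>.\<close>

lemma delayed_compose:
  fixes F :: "(nat \<Rightarrow> 'a) \<Rightarrow> (nat \<Rightarrow> 'b) \<Rightarrow> nat \<Rightarrow> 'd"
    and G :: "(nat \<Rightarrow> 'a) \<Rightarrow> (nat \<Rightarrow> 'e) \<Rightarrow> nat \<Rightarrow> 'b"
  assumes "delayed K F" "delayed M G"
  shows "delayed (M + K) (\<lambda>w t. F w (G w t))"
  unfolding delayed_def
proof (intro allI impI)
  fix w w' :: "nat \<Rightarrow> 'a" and t t' :: "nat \<Rightarrow> 'e" and i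
  assume a: "\<forall>j\<le>i. w j = w' j" "\<forall>j. j + (M + K) \<le> i \<longrightarrow> t j = t' j"
  have "G w t j = G w' t' j" if "j + K \<le> i" for j
    by (rule delayedD[OF assms(2)]) (use a that in auto)
  then show "F w (G w t) i = F w' (G w' t') i"
    by (intro delayedD[OF assms(1)]) (use a in auto)
qed

lemma delayed_mono: "delayed K F \<Longrightarrow> M \<le> K \<Longrightarrow> delayed M F"
  unfolding delayed_def by auto

text \<open>Causal strategies are built from a memory with an invariant: choice functions for the
  move and the next memory are iterated along the word. The memory before letter \<open>n\<close>
  knows only the letters before \<open>n\<close>.\<close>

lemma machine:
  fixes Inv :: "'m \<Rightarrow> bool"
  assumes inv0: "Inv m0"
    and step: "\<And>m a. Inv m \<Longrightarrow> a \<in> Sg \<Longrightarrow> \<exists>t m'. step m a t m' \<and> Inv m'"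
  obtains R M where "wcausal R"
    and "\<And>w w' n. (\<And>j. j < n \<Longrightarrow> w j = w' j) \<Longrightarrow> M w n = M w' n"
    and "\<And>w. M w 0 = m0"
    and "\<And>w i. wordin Sg w \<Longrightarrow> Inv (M w i) \<and> step (M w i) (w i) (R w i) (M w (Suc i))"
proof -
  obtain f g where fg: "\<And>m a. Inv m \<Longrightarrow> a \<in> Sg \<Longrightarrow> step m a (f m a) (g m a) \<and> Inv (g m a)"
    using step by metis
  define M where "M w n = rec_nat m0 (\<lambda>i m. g m (w i)) n" for w n
  have M0: "M w 0 = m0" and MS: "M w (Suc i) = g (M w i) (w i)" for w i
    by (auto simp: M_def)
  define R where "R w i = f (M w i) (w i)" for w i
  have Mc: "(\<And>j. j < n \<Longrightarrow> w j = w' j) \<Longrightarrow> M w n = M w' n" for w w' n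
    by (induction n) (auto simp: M0 MS)
  have Rc: "wcausal R" unfolding wcausal_def R_def
  proof (intro allI impI)
    fix w w' :: "nat \<Rightarrow> 'a" and i assume a: "\<forall>j\<le>i. w j = w' j"
    have "M w i = M w' i" by (rule Mc) (use a in auto)
    then show "f (M w i) (w i) = f (M w' i) (w' i)" using a by simp
  qed
  have Mi: "Inv (M w i)" if "wordin Sg w" for w i
    using that by (induction i) (auto simp: M0 MS inv0 fg wordin_def)
  show ?thesis
  proof (rule that[of R M, OF Rc Mc M0])
    fix w i assume w: "wordin Sg w"
    then show "Inv (M w i) \<and> step (M w i) (w i) (R w i) (M w (Suc i))"
      using Mi[OF w, of i] fg[of "M w i" "w i"] by (simp add: MS R_def wordin_def)
  qed
qed

section \<open>One-token games\<close>

locale game =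
  fixes D :: "('s,'a) trans set" and Sg :: "'a set" and acc :: "(nat \<Rightarrow> ('s,'a) trans) \<Rightarrow> bool"
  assumes acc_shift: "acc (\<lambda>i. r (n + i)) \<longleftrightarrow> acc r"
begin

text \<open>Eve's play has to be a run against every \<open>t\<close>, even one with illegal moves,
  so that strategies compose without side conditions. \<open>repair\<close> brings strategies into
  this form.\<close>

definition wins where
  "wins F p q \<longleftrightarrow> delayed 1 F \<and> (\<forall>w t. wordin Sg w \<longrightarrow> runf D p w (F w t) \<and>
     (runf D q w t \<and> acc t \<longrightarrow> acc (F w t)))"

definition dom where "dom p q \<longleftrightarrow> (\<exists>F. wins F p q)"

text \<open>The run that beats \<open>s\<close> from \<open>q\<close> serves as the token against
  which Eve plays from \<open>p\<close>. The composition has delay 2, hence also delay 1.\<close>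

lemma dom_trans:
  assumes "dom p q" "dom q s"
  shows "dom p s"
proof -
  obtain F G where F: "wins F p q" and G: "wins G q s"
    using assms by (auto simp: dom_def)
  have "delayed 1 (\<lambda>w t. F w (G w t))"
    using delayed_compose[of 1 F 1 G] F G by (auto simp: wins_def intro: delayed_mono)
  then have "wins (\<lambda>w t. F w (G w t)) p s"
    using F G by (auto simp: wins_def)
  then show ?thesis by (auto simp: dom_def)
qed

lemma acc_conc [simp]: "acc (conc n t t') \<longleftrightarrow> acc t'"
  using acc_shift[of "conc n t t'" n] by simp

text \<open>A winning strategy with its past fixed to \<open>w\<close> and \<open>t\<close> still
  wins the rest of the game. Delay 1 makes Eve's past moves independent of the continuation.\<close>

lemma wins_residual:
  assumes F: "wins F p q" and w: "wordin Sg w" and t: "runp D q w t n"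
  shows "dom (st p (F w t) n) (st q t n)"
proof -
  define F' where "F' w2 t2 i = F (conc n w w2) (conc n t t2) (n + i)" for w2 t2 i
  have dF: "delayed 1 F" using F by (simp add: wins_def)
  have dl: "delayed 1 F'"
    unfolding delayed_def F'_def
  proof (intro allI impI)
    fix w1 w2 :: "nat \<Rightarrow> 'a" and t1 t2 :: "nat \<Rightarrow> ('s,'a) trans" and i
    assume "\<forall>j\<le>i. w1 j = w2 j" "\<forall>j. j + 1 \<le> i \<longrightarrow> t1 j = t2 j"
    then show "F (conc n w w1) (conc n t t1) (n + i) = F (conc n w w2) (conc n t t2) (n + i)"
      by (intro delayedD[OF dF]) (auto simp: conc_def)
  qed
  have same: "st p (F (conc n w w2) (conc n t t2)) n = st p (F w t) n" for w2 t2
    by (intro st_cong delayedD[OF dF]) auto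
  have run: "runf D (st p (F w t) n) w2 (F' w2 t2)" if "wordin Sg w2" for w2 t2
  proof -
    have "runf D p (conc n w w2) (F (conc n w w2) (conc n t t2))"
      using F wordin_conc[OF w that] by (auto simp: wins_def)
    from runf_shift[OF this, of n] show ?thesis unfolding F'_def same by simp
  qed
  have "acc (F' w2 t2)" if "wordin Sg w2" "runf D (st q t n) w2 t2" "acc t2" for w2 t2
  proof -
    have "acc (F (conc n w w2) (conc n t t2))"
      using F wordin_conc[OF w that(1)] runf_conc[OF t that(2)] that(3) by (auto simp: wins_def)
    then show ?thesis
      unfolding F'_def using acc_shift[of "F (conc n w w2) (conc n t t2)" n] by blast
  qed
  then have "wins F' (st p (F w t) n) (st q t n)"
    using dl run by (auto simp: wins_def)
  then show ?thesis by (auto simp: dom_def)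
qed

text \<open>Eve's first move precedes that of the token, so one successor \<open>p'\<close> serves
  all successors \<open>q'\<close>; it dominates them by \<open>wins_residual\<close>.\<close>

lemma dom_step:
  assumes "dom p q" "a \<in> Sg"
  shows "\<exists>p'. (p, a, p') \<in> D \<and> (\<forall>q'. (q, a, q') \<in> D \<longrightarrow> dom p' q')"
proof -
  obtain F where F: "wins F p q" using assms by (auto simp: dom_def)
  define w :: "nat \<Rightarrow> 'a" where "w = (\<lambda>_. a)"
  have w: "wordin Sg w" using assms by (auto simp: wordin_def w_def)
  define t0 where "t0 = F w undefined 0"
  have dF: "delayed 1 F" using F by (simp add: wins_def)
  have t0: "F w t 0 = t0" for t
    unfolding t0_def by (rule delayedD[OF dF]) auto
  have "runf D p w (F w undefined)" using F w by (auto simp: wins_def)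
  then have "t0 \<in> D \<and> lbl t0 = w 0 \<and> src t0 = st p (F w undefined) 0"
    unfolding runf_def t0_def by blast
  then have "t0 \<in> D" "lbl t0 = a" "src t0 = p"
    by (simp_all add: w_def)
  then have "(p, a, tgt t0) \<in> D" by (metis trans_collapse)
  moreover have "dom (tgt t0) q'" if "(q, a, q') \<in> D" for q'
  proof -
    have "runp D q w (\<lambda>_. (q, a, q')) (Suc 0)"
      using that by (simp add: runp_def w_def)
    from wins_residual[OF F w this] show ?thesis by (simp add: t0)
  qed
  ultimately show ?thesis by blast
qed

text \<open>A chain of copies of the same strategy, each playing against the next one, lags one step
  behind per link: Eve hence tolerates an opponent token that moves with any fixed lookahead.\<close>
lemma dom_lookahead:
  assumes "dom p p" "dom p q"
  shows "\<exists>F. delayed (Suc K) F \<and> (\<forall>w t. wordin Sg w \<longrightarrow> runf D p w (F w t) \<and>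
     (runf D q w t \<and> acc t \<longrightarrow> acc (F w t)))"
proof (induction K)
  case 0
  then show ?case using assms(2) by (auto simp: dom_def wins_def)
next
  case (Suc K)
  then obtain G where G: "delayed (Suc K) G" "\<And>w t. wordin Sg w \<Longrightarrow> runf D p w (G w t)"
     "\<And>w t. wordin Sg w \<Longrightarrow> runf D q w t \<Longrightarrow> acc t \<Longrightarrow> acc (G w t)" by blast
  obtain F where F: "wins F p p" using assms by (auto simp: dom_def)
  have "delayed (Suc (Suc K)) (\<lambda>w t. F w (G w t))"
    using delayed_compose[of 1 F "Suc K" G] F G by (auto simp: wins_def)
  then show ?case using F G by (intro exI[of _ "\<lambda>w t. F w (G w t)"]) (auto simp: wins_def)
qed

end

section \<open>Forcing finite blocks of letters\<close>

fun is_path :: "('s,'a) trans set \<Rightarrow> 's \<Rightarrow> ('s,'a) trans list \<Rightarrow> bool" where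
  "is_path D p [] \<longleftrightarrow> True"
| "is_path D p (t # ts) \<longleftrightarrow> t \<in> D \<and> src t = p \<and> is_path D (tgt t) ts"

definition endst :: "'s \<Rightarrow> ('s,'a) trans list \<Rightarrow> 's" where
  "endst p ts = (if ts = [] then p else tgt (last ts))"

lemma endst_simps [simp]: "endst p [] = p" "endst p (t # ts) = endst (tgt t) ts"
  by (auto simp: endst_def)

lemma endst_append [simp]: "endst p (xs @ ys) = endst (endst p xs) ys"
  by (induction xs arbitrary: p) auto

lemma is_path_append [simp]: "is_path D p (xs @ ys) \<longleftrightarrow> is_path D p xs \<and> is_path D (endst p xs) ys"
  by (induction xs arbitrary: p) auto

lemma runp_endst: "m \<le> n \<Longrightarrow> endst (st p r m) (map r [m..<n]) = st p r n"
  by (induction n) (auto simp: le_Suc_eq)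

lemma runp_is_path:
  "runp D p w r n \<Longrightarrow> m \<le> n \<Longrightarrow> is_path D (st p r m) (map r [m..<n]) \<and> map lbl (map r [m..<n]) = map w [m..<n]"
  by (induction n) (auto simp: le_Suc_eq runp_Suc runp_endst)

lemma runf_is_path:
  assumes "runf D p w r" "m \<le> n"
  shows "is_path D (st p r m) (map r [m..<n])" "map lbl (map r [m..<n]) = map w [m..<n]"
  using runp_is_path[of D p w r n m] assms by (simp_all add: runf_iff)

lemma is_path_runp:
  "is_path D p xs \<Longrightarrow> runp D p (\<lambda>i. lbl (xs ! i)) (\<lambda>i. xs ! i) (length xs)"
proof (induction xs rule: rev_induct)
  case (snoc t xs)
  have "runp D p (\<lambda>i. lbl ((xs @ [t]) ! i)) (\<lambda>i. (xs @ [t]) ! i) (length xs)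
     \<longleftrightarrow> runp D p (\<lambda>i. lbl (xs ! i)) (\<lambda>i. xs ! i) (length xs)"
    by (rule runp_cong) (auto simp: nth_append)
  moreover have "st p (\<lambda>i. (xs @ [t]) ! i) (length xs) = endst p xs"
    by (cases xs rule: rev_cases) (auto simp: nth_append)
  ultimately show ?case using snoc by (simp add: runp_Suc)
qed simp

lemma runp_conc:
  assumes "runp D p w r n" "runp D (st p r n) w' r' m"
  shows "runp D p (conc n w w') (conc n r r') (n + m)"
  using assms(2)
proof (induction m)
  case 0
  have "runp D p (conc n w w') (conc n r r') n \<longleftrightarrow> runp D p w r n"
    by (rule runp_cong) auto
  then show ?case using assms(1) by simp
next
  case (Suc m)
  then show ?case by (simp add: runp_Suc st_conc)
qed

section \<open>Bounded forcing by Adam\<close>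

context game
begin

text \<open>Adam can choose at most \<open>n\<close> further letters, whatever Eve answers, so that at some
  moment the list of Eve's transitions, which extends \<open>h\<close>, satisfies \<open>P\<close>.\<close>
primrec force :: "(('s,'a) trans list \<Rightarrow> bool) \<Rightarrow> nat \<Rightarrow> ('s,'a) trans list \<Rightarrow> 's \<Rightarrow> bool" where
  "force P 0 h p \<longleftrightarrow> P h"
| "force P (Suc n) h p \<longleftrightarrow> P h \<or> (\<exists>a\<in>Sg. \<forall>p'. (p, a, p') \<in> D \<longrightarrow> force P n (h @ [(p, a, p')]) p')"

lemma force_Suc: "force P n h p \<Longrightarrow> force P (Suc n) h p"
proof (induction n arbitrary: h p)
  case (Suc n)
  then show ?case by (metis force.simps(2))
qed simp

lemma force_mono: "force P n h p \<Longrightarrow> n \<le> m \<Longrightarrow> force P m h p"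
  by (induction m) (auto simp: le_Suc_eq simp del: force.simps intro: force_Suc)

lemma force_weaken: "force P n h p \<Longrightarrow> (\<And>h. P h \<Longrightarrow> Q h) \<Longrightarrow> force Q n h p"
proof (induction n arbitrary: h p)
  case (Suc n)
  then show ?case by (metis force.simps(2))
qed simp

text \<open>Eve has finitely many answers to \<open>a\<close>. If Adam could force \<open>P\<close>
  after each of them, the sum of the bounds would be a common bound and he could force
  \<open>P\<close> from \<open>p\<close>.\<close>

lemma not_force_step:
  assumes fin: "finite D" and nf: "\<And>n. \<not> force P n h p" and a: "a \<in> Sg"
  shows "\<exists>p'. (p, a, p') \<in> D \<and> (\<forall>n. \<not> force P n (h @ [(p, a, p')]) p')"
proof (rule ccontr)
  assume "\<not> ?thesis"
  then have "\<forall>p'. (p, a, p') \<in> D \<longrightarrow> (\<exists>n. force P n (h @ [(p, a, p')]) p')" by blast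
  then obtain f where f: "\<And>p'. (p, a, p') \<in> D \<Longrightarrow> force P (f p') (h @ [(p, a, p')]) p'" by metis
  define S where "S = {p'. (p, a, p') \<in> D}"
  have "S \<subseteq> tgt ` D" by (auto simp: S_def intro: rev_image_eqI)
  then have finS: "finite S" using fin by (meson finite_imageI finite_subset)
  have "force P (\<Sum>x\<in>S. f x) (h @ [(p, a, p')]) p'" if "(p, a, p') \<in> D" for p'
    using f[OF that] by (rule force_mono) (use finS that in \<open>auto simp: S_def intro!: member_le_sum\<close>)
  then have "force P (Suc (\<Sum>x\<in>S. f x)) h p" using a by auto
  then show False using nf by blast
qed

text \<open>Against the causal \<open>R\<close>, Adam's forcing choices are realised by rewriting
  letters from \<open>U\<close> on, one at a time; Eve's moves before \<open>U\<close> stay the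
  same.\<close>

lemma force_play:
  assumes R: "wcausal R" "\<And>w. wordin Sg w \<Longrightarrow> runf D p0 w (R w)"
    and "wordin Sg w" "T \<le> U" "force P n (map (R w) [T..<U]) (st p0 (R w) U)"
  shows "\<exists>w' m. wordin Sg w' \<and> (\<forall>j<U. w' j = w j) \<and> U \<le> m \<and> m \<le> U + n \<and> P (map (R w') [T..<m])"
  using assms(3-)
proof (induction n arbitrary: w U)
  case 0
  then show ?case by (intro exI[of _ w] exI[of _ U]) auto
next
  case (Suc n)
  show ?case
  proof (cases "P (map (R w) [T..<U])")
    case True
    then show ?thesis using Suc.prems by (intro exI[of _ w] exI[of _ U]) auto
  next
    case False
    then obtain a where a: "a \<in> Sg" and
      fa: "\<And>p'. (st p0 (R w) U, a, p') \<in> D \<Longrightarrow> force P n (map (R w) [T..<U] @ [(st p0 (R w) U, a, p')]) p'"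
      using Suc.prems by auto
    define v where "v = w(U := a)"
    have v: "wordin Sg v" using Suc.prems a by (auto simp: v_def wordin_def)
    have eq: "R v j = R w j" if "j < U" for j
      by (rule wcausalD[OF R(1)]) (use that in \<open>auto simp: v_def\<close>)
    have "st p0 (R v) U = st p0 (R w) U" by (rule st_cong) (auto simp: eq)
    then have RU: "R v U \<in> D" "lbl (R v U) = a" "src (R v U) = st p0 (R w) U"
      using R(2)[OF v] by (auto simp: runf_def v_def)
    then have "R v U = (st p0 (R w) U, a, tgt (R v U))" by (metis trans_collapse)
    then have "force P n (map (R w) [T..<U] @ [R v U]) (tgt (R v U))"
      using fa[of "tgt (R v U)"] RU(1) by simp
    moreover have "map (R v) [T..<U] = map (R w) [T..<U]" using eq by auto
    then have "map (R v) [T..<Suc U] = map (R w) [T..<U] @ [R v U]" using \<open>T \<le> U\<close> by simp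
    ultimately have "force P n (map (R v) [T..<Suc U]) (st p0 (R v) (Suc U))"
      by (simp only: st_Suc)
    from Suc.IH[OF v _ this] obtain w' m where "wordin Sg w'" "\<forall>j<Suc U. w' j = v j" "Suc U \<le> m"
       "m \<le> Suc U + n" "P (map (R w') [T..<m])" using \<open>T \<le> U\<close> by auto
    then show ?thesis by (intro exI[of _ w'] exI[of _ m]) (auto simp: v_def)
  qed
qed

text \<open>During a block Eve's moves depend on \<open>x\<close> only up to the start of the block, so
  Adam first plays the letters of the block and then moves \<open>x\<close> knowing all of them.\<close>
lemma block_step:
  assumes F: "delayed K F" "\<And>w t. wordin Sg w \<Longrightarrow> runf D p0 w (F w t)"
    and w: "wordin Sg w" and x: "runp D x0 w x T"
    and fc: "force (\<lambda>h. h \<noteq> [] \<and> (\<exists>xs. is_path D (st x0 x T) xs \<and> map lbl xs = map lbl h \<and>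
        (endst (st p0 (F w x) T) h, endst (st x0 x T) xs) \<in> I \<and> Q h xs)) K [] (st p0 (F w x) T)"
  shows "\<exists>w' x' T'. wordin Sg w' \<and> runp D x0 w' x' T' \<and> (st p0 (F w' x') T', st x0 x' T') \<in> I \<and>
     T < T' \<and> (\<forall>j<T. w' j = w j \<and> x' j = x j) \<and> Q (map (F w' x') [T..<T']) (map x' [T..<T'])"
proof -
  define R where "R w = F w x" for w
  have R: "wcausal R" "\<And>w. wordin Sg w \<Longrightarrow> runf D p0 w (R w)"
    using F unfolding wcausal_def R_def by (auto intro: delayedD[OF F(1)])
  have "force (\<lambda>h. h \<noteq> [] \<and> (\<exists>xs. is_path D (st x0 x T) xs \<and> map lbl xs = map lbl h \<and>
        (endst (st p0 (F w x) T) h, endst (st x0 x T) xs) \<in> I \<and> Q h xs)) K (map (R w) [T..<T]) (st p0 (R w) T)"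
    using fc by (simp add: R_def)
  from force_play[OF R w order_refl this]
  obtain w' T' xs where w': "wordin Sg w'" "\<forall>j<T. w' j = w j" and T': "T \<le> T'" "T' \<le> T + K"
    and ne: "map (R w') [T..<T'] \<noteq> []" and xs: "is_path D (st x0 x T) xs"
    "map lbl xs = map lbl (map (R w') [T..<T'])"
    "(endst (st p0 (F w x) T) (map (R w') [T..<T']), endst (st x0 x T) xs) \<in> I"
    "Q (map (R w') [T..<T']) xs"
    by blast
  have len: "length xs = T' - T" using arg_cong[OF xs(2), of length] by simp
  define x' where "x' = conc T x (\<lambda>i. xs ! i)"
  \<comment> \<open>As \<open>T' \<le> T + K\<close>, delay \<open>K\<close> means that these moves
    read the token only before \<open>T\<close>, where \<open>x'\<close> and \<open>x\<close>
    agree.\<close>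
  have Feq: "F w' x' j = R w' j" if "j < T'" for j
    unfolding R_def by (rule delayedD[OF F(1)]) (use that T' in \<open>auto simp: x'_def\<close>)
  have mF: "map (F w' x') [T..<T'] = map (R w') [T..<T']" using Feq by auto
  have mx: "map x' [T..<T'] = xs"
    by (rule nth_equalityI) (auto simp: len x'_def)
  have Rl: "lbl (R w' i) = w' i" for i using R(2)[OF w'(1)] by (auto simp: runf_def)
  have lx: "lbl (xs ! i) = w' (T + i)" if "i < T' - T" for i
    using arg_cong[OF xs(2), of "\<lambda>l. l ! i"] that len by (simp add: Rl)
  have "runp D x0 (conc T w (\<lambda>i. lbl (xs ! i))) x' (T + (T' - T))"
    unfolding x'_def using runp_conc[OF x is_path_runp[OF xs(1)]] len by simp
  moreover have "conc T w (\<lambda>i. lbl (xs ! i)) j = w' j" if "j < T'" for j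
    using that w'(2) lx[of "j - T"] by (auto simp: conc_def)
  ultimately have rx: "runp D x0 w' x' T'"
    using T' runp_cong[of T' x' x' "conc T w (\<lambda>i. lbl (xs ! i))" w' D x0] by auto
  have sx: "st x0 x' T = st x0 x T" by (rule st_cong) (auto simp: x'_def)
  have sF: "st p0 (F w' x') T = st p0 (F w x) T"
    by (rule st_cong, rule delayedD[OF F(1)]) (use w' in \<open>auto simp: x'_def\<close>)
  have "(st p0 (F w' x') T', st x0 x' T') \<in> I"
    using xs(3) runp_endst[OF T'(1), of p0 "F w' x'"] runp_endst[OF T'(1), of x0 x']
    unfolding mF mx sx sF by simp
  moreover have "T < T'" using ne by auto
  moreover have "Q (map (F w' x') [T..<T']) (map x' [T..<T'])" unfolding mF mx by (rule xs(4))
  ultimately show ?thesis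
    using w' rx by (intro exI[of _ w'] exI[of _ x'] exI[of _ T']) (auto simp: x'_def)
qed

text \<open>Dependent choice iterates \<open>block_step\<close>, and the growing prefixes converge
  to one infinite play.\<close>

lemma blocks:
  assumes F: "delayed K F" "\<And>w t. wordin Sg w \<Longrightarrow> runf D p0 w (F w t)"
    and I0: "(p0, x0) \<in> I" and w0: "wordin Sg w0"
    and fc: "\<And>p x k. (p, x) \<in> I \<Longrightarrow> force (\<lambda>h. h \<noteq> [] \<and> (\<exists>xs. is_path D x xs \<and> map lbl xs = map lbl h \<and>
        (endst p h, endst x xs) \<in> I \<and> Q k h xs)) K [] p"
  shows "\<exists>w x T. wordin Sg w \<and> runf D x0 w x \<and> T 0 = 0 \<and> strict_mono T \<and>
     (\<forall>k. Q k (map (F w x) [T k..<T (Suc k)]) (map x [T k..<T (Suc k)]))"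
proof -
  define good where "good k s \<longleftrightarrow> (case s of (w, x, T) \<Rightarrow> wordin Sg w \<and> runp D x0 w x T \<and>
     (st p0 (F w x) T, st x0 x T) \<in> I \<and> (k = 0 \<longrightarrow> T = 0))" for k :: nat and s
  define nxt where "nxt k s s' \<longleftrightarrow> (case s of (w, x, T) \<Rightarrow> case s' of (w', x', T') \<Rightarrow>
     T < T' \<and> (\<forall>j<T. w' j = w j \<and> x' j = x j) \<and> Q k (map (F w' x') [T..<T']) (map x' [T..<T']))" for k s s'
  have "\<exists>f. \<forall>k. good k (f k) \<and> nxt k (f k) (f (Suc k))"
  proof (rule dependent_nat_choice)
    show "\<exists>s. good 0 s"
      using I0 w0 by (intro exI[of _ "(w0, undefined, 0)"]) (auto simp: good_def)
  next
    fix s k assume g: "good k s"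
    obtain w x T where s: "s = (w, x, T)" by (cases s)
    have "(st p0 (F w x) T, st x0 x T) \<in> I" using g by (auto simp: good_def s)
    from block_step[OF F _ _ fc[OF this], of k] g
    obtain w' x' T' where "wordin Sg w' \<and> runp D x0 w' x' T' \<and> (st p0 (F w' x') T', st x0 x' T') \<in> I \<and>
     T < T' \<and> (\<forall>j<T. w' j = w j \<and> x' j = x j) \<and> Q k (map (F w' x') [T..<T']) (map x' [T..<T'])"
      unfolding good_def s by auto
    then show "\<exists>s'. good (Suc k) s' \<and> nxt k s s'"
      by (intro exI[of _ "(w', x', T')"]) (auto simp: good_def nxt_def s)
  qed
  then obtain f where f: "\<And>k. good k (f k)" "\<And>k. nxt k (f k) (f (Suc k))" by blast
  define W X T where "W k = fst (f k)" and "X k = fst (snd (f k))" and "T k = snd (snd (f k))" for k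
  have fk: "f k = (W k, X k, T k)" for k by (simp add: W_def X_def T_def)
  have g: "wordin Sg (W k)" "runp D x0 (W k) (X k) (T k)" for k
    using f(1)[of k] by (auto simp: good_def fk)
  have T0: "T 0 = 0" using f(1)[of 0] by (auto simp: good_def fk)
  have n: "T k < T (Suc k)" "\<And>j. j < T k \<Longrightarrow> W (Suc k) j = W k j \<and> X (Suc k) j = X k j"
     "Q k (map (F (W (Suc k)) (X (Suc k))) [T k..<T (Suc k)]) (map (X (Suc k)) [T k..<T (Suc k)])" for k
    using f(2)[of k] by (auto simp: nxt_def fk)
  have sm: "strict_mono T" using n(1) by (rule strict_mono_Suc_iff[THEN iffD2, rule_format])
  have le: "k \<le> T k" for k using sm by (rule strict_mono_imp_increasing)
  \<comment> \<open>Stage \<open>k\<close> is final below \<open>T k\<close>, and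
    \<open>i < T (Suc i)\<close>, so stage \<open>Suc i\<close> already settles position
    \<open>i\<close>.\<close>
  define w x where "w i = W (Suc i) i" and "x i = X (Suc i) i" for i
  have stab: "W (k + d) j = W k j \<and> X (k + d) j = X k j" if "j < T k" for k d j
  proof (induction d)
    case (Suc d)
    have "T k \<le> T (k + d)" using sm by (simp add: strict_mono_less_eq)
    then show ?case using Suc n(2)[of j "k + d"] that by simp
  qed simp
  have lim: "w j = W k j \<and> x j = X k j" if "j < T k" for k j
  proof (cases "k \<le> Suc j")
    case True
    then show ?thesis using stab[OF that, of "Suc j - k"] by (simp add: w_def x_def)
  next
    case False
    moreover have "j < T (Suc j)" using le[of "Suc j"] by simp
    ultimately show ?thesis using stab[of j "Suc j" "k - Suc j"] by (simp add: w_def x_def)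
  qed
  have ww: "wordin Sg w" using g(1) by (auto simp: wordin_def w_def)
  have "runp D x0 w x (T k)" for k
    using g(2)[of k] runp_cong[of "T k" x "X k" w "W k" D x0] lim[of _ k] by auto
  then have rx: "runf D x0 w x" unfolding runf_iff by (metis runp_mono[OF _ le])
  have "Q k (map (F w x) [T k..<T (Suc k)]) (map x [T k..<T (Suc k)])" for k
  proof -
    have "F w x i = F (W (Suc k)) (X (Suc k)) i" if "i < T (Suc k)" for i
      by (rule delayedD[OF F(1)]) (use that lim[of _ "Suc k"] in auto)
    then have "map (F w x) [T k..<T (Suc k)] = map (F (W (Suc k)) (X (Suc k))) [T k..<T (Suc k)]" by auto
    moreover have "map x [T k..<T (Suc k)] = map (X (Suc k)) [T k..<T (Suc k)]"
      using lim[of _ "Suc k"] by auto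
    ultimately show ?thesis using n(3)[of k] by (simp only:)
  qed
  then show ?thesis using ww rx T0 sm by blast
qed

end

section \<open>Elementary facts on finite sets and sequences of natural numbers\<close>

lemma uniform_bound:
  assumes "finite A" "\<And>a. a \<in> A \<Longrightarrow> \<exists>n::nat. \<forall>m\<ge>n. P a m"
  shows "\<exists>n. \<forall>a\<in>A. \<forall>m\<ge>n. P a m"
  using assms
proof (induction A rule: finite_induct)
  case (insert x F)
  obtain n1 where "\<forall>a\<in>F. \<forall>m\<ge>n1. P a m" using insert.IH insert.prems by auto
  moreover obtain n2 where "\<forall>m\<ge>n2. P x m" using insert.prems by auto
  ultimately show ?case by (intro exI[of _ "max n1 n2"]) auto
qed simp

lemma cyclic_enumeration:
  assumes "finite C" "C \<noteq> {}"
  shows "\<exists>e. (\<forall>j. e j \<in> C) \<and> (\<forall>c\<in>C. \<forall>n. \<exists>j\<ge>n::nat. e j = c)"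
proof -
  obtain xs where xs: "set xs = C" using assms finite_list by blast
  then have ne: "xs \<noteq> []" using assms by auto
  define e where "e j = xs ! (j mod length xs)" for j
  have "e j \<in> C" for j using xs ne by (auto simp: e_def intro!: nth_mem)
  moreover have "\<exists>j\<ge>n. e j = c" if c: "c \<in> C" for c n
  proof -
    obtain i where i: "i < length xs" "xs ! i = c" using c xs by (auto simp: in_set_conv_nth)
    have "n \<le> n * length xs + i" using ne by (cases "length xs") auto
    moreover have "e (n * length xs + i) = c" using i by (simp add: e_def)
    ultimately show ?thesis by blast
  qed
  ultimately show ?thesis by blast
qed

lemma nat_no_infinite_descent:
  fixes N :: "nat \<Rightarrow> nat"
  assumes "\<And>i. i \<ge> s \<Longrightarrow> N (Suc i) \<le> N i" and drop: "\<And>i. i \<ge> s \<Longrightarrow> \<exists>i'\<ge>i. N (Suc i') < N i'"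
  shows False
proof -
  have dec: "N (i + d) \<le> N i" if "i \<ge> s" for i d
    using that assms(1)[of "i + d" for d] by (induction d) (auto intro: le_trans)
  have "\<exists>i\<ge>s. N i + n \<le> N s" for n
  proof (induction n)
    case (Suc n)
    then obtain i where i: "i \<ge> s" "N i + n \<le> N s" by blast
    obtain i' where i': "i' \<ge> i" "N (Suc i') < N i'" using drop i(1) by blast
    have "N i' \<le> N i" using dec[OF i(1), of "i' - i"] i' by simp
    then show ?case using i i' by (intro exI[of _ "Suc i'"]) auto
  qed auto
  from this[of "Suc (N s)"] show False by auto
qed

lemma strict_mono_block:
  assumes "strict_mono T" "T 0 = (0::nat)"
  shows "\<exists>k. T k \<le> i \<and> i < T (Suc k)"
proof (induction i)
  case 0
  have "T 0 < T (Suc 0)" using strict_monoD[OF assms(1)] by simp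
  then show ?case using assms by (intro exI[of _ 0]) simp
next
  case (Suc i)
  then obtain k where k: "T k \<le> i" "i < T (Suc k)" by blast
  have "T (Suc k) < T (Suc (Suc k))" using strict_monoD[OF assms(1)] by simp
  then have "T (Suc k) \<le> Suc i \<and> Suc i < T (Suc (Suc k)) \<or> T k \<le> Suc i \<and> Suc i < T (Suc k)"
    using k by linarith
  then show ?case by blast
qed

context game
begin

lemma force_path:
  "is_path D p0 h \<Longrightarrow> force P n h (endst p0 h) \<Longrightarrow> force (\<lambda>h. P h \<and> is_path D p0 h) n h (endst p0 h)"
proof (induction n arbitrary: h)
  case (Suc n)
  show ?case
  proof (cases "P h")
    case True
    then show ?thesis using Suc.prems by simp
  next
    case False
    then obtain a where a: "a \<in> Sg"
      "\<And>p'. (endst p0 h, a, p') \<in> D \<Longrightarrow> force P n (h @ [(endst p0 h, a, p')]) p'"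
      using Suc.prems(2) by auto
    have "force (\<lambda>h. P h \<and> is_path D p0 h) n (h @ [(endst p0 h, a, p')]) p'"
      if "(endst p0 h, a, p') \<in> D" for p'
      using Suc.IH[of "h @ [(endst p0 h, a, p')]"] a(2)[OF that] Suc.prems(1) that by simp
    then show ?thesis using a(1) by auto
  qed
qed simp

end

section \<open>Arenas of mutually dominating states\<close>

text \<open>The class of a successor depends only on the class and the letter. Runs on the same word
  from one class therefore stay equivalent, and each can be chased from any other by a one-token
  strategy.\<close>

locale arena = game D Sg acc
  for D :: "('s,'a) trans set" and Sg :: "'a set" and acc :: "(nat \<Rightarrow> ('s,'a) trans) \<Rightarrow> bool" +
  fixes V :: "'s set" and cls :: "'s \<Rightarrow> 'k"
  assumes finite_V: "finite V" and finite_Sg: "finite Sg" and D_sub: "D \<subseteq> V \<times> Sg \<times> V"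
    and total: "p \<in> V \<Longrightarrow> a \<in> Sg \<Longrightarrow> \<exists>p'. (p, a, p') \<in> D"
    and cls_step: "(p, a, p') \<in> D \<Longrightarrow> (q, a, q') \<in> D \<Longrightarrow> cls p = cls q \<Longrightarrow> cls p' = cls q'"
    and cls_dom: "p \<in> V \<Longrightarrow> q \<in> V \<Longrightarrow> cls p = cls q \<Longrightarrow> dom p q"
begin

definition resolvable :: "'s \<Rightarrow> bool" where
  "resolvable p \<longleftrightarrow> (\<exists>R. wcausal R \<and> (\<forall>w. wordin Sg w \<longrightarrow> runf D p w (R w) \<and>
     ((\<exists>r. runf D p w r \<and> acc r) \<longrightarrow> acc (R w))))"

lemma finite_D: "finite D"
  using D_sub finite_V finite_Sg by (meson finite_SigmaI finite_subset)

lemma D_V: "t \<in> D \<Longrightarrow> src t \<in> V \<and> lbl t \<in> Sg \<and> tgt t \<in> V"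
  using D_sub by (cases t) auto

lemma path_V: "is_path D p xs \<Longrightarrow> p \<in> V \<Longrightarrow> endst p xs \<in> V"
  by (induction xs arbitrary: p) (auto simp: D_V)

lemma tgt_cls:
  assumes "s \<in> D" "t \<in> D" "lbl s = lbl t" "cls (src s) = cls (src t)"
  shows "cls (tgt s) = cls (tgt t)"
  using cls_step[of "src s" "lbl s" "tgt s" "src t" "tgt t"] assms by (cases s; cases t) auto

lemma path_cls:
  "is_path D p xs \<Longrightarrow> is_path D q ys \<Longrightarrow> map lbl xs = map lbl ys \<Longrightarrow> cls p = cls q \<Longrightarrow>
    cls (endst p xs) = cls (endst q ys)"
proof (induction xs arbitrary: p q ys)
  case (Cons x xs)
  then obtain y ys' where "ys = y # ys'" by (cases ys) auto
  then show ?case using Cons.IH[of "tgt x" "tgt y" ys'] Cons.prems tgt_cls[of x y] by auto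
qed simp

lemma run_V: "runf D p w r \<Longrightarrow> p \<in> V \<Longrightarrow> st p r n \<in> V"
  using D_V by (cases n) (auto simp: runf_def)

lemma run_cls:
  assumes "runf D p w r" "runf D q w r'" "cls p = cls q"
  shows "cls (st p r n) = cls (st q r' n)"
proof (induction n)
  case (Suc n)
  then show ?case using tgt_cls[of "r n" "r' n"] assms by (auto simp: runf_def)
qed (use assms in simp)

lemma acc_transfer:
  assumes "p \<in> V" "q \<in> V" "cls p = cls q" "wordin Sg w" "runf D q w t" "acc t"
  shows "\<exists>r. runf D p w r \<and> acc r"
  using cls_dom[OF assms(1-3)] assms(4-) by (auto simp: dom_def wins_def)

lemma default_run:
  assumes "p \<in> V"
  obtains R where "wcausal R" "\<And>w. wordin Sg w \<Longrightarrow> runf D p w (R w)"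
proof -
  have ex: "\<exists>t m'. (t \<in> D \<and> src t = m \<and> lbl t = a \<and> m' = tgt t) \<and> m' \<in> V" if "m \<in> V" "a \<in> Sg" for m a
    using total[OF that] D_V by (metis trans_simps)
  from machine[of "\<lambda>m. m \<in> V" p Sg "\<lambda>m a t m'. t \<in> D \<and> src t = m \<and> lbl t = a \<and> m' = tgt t", OF assms ex]
  obtain R M where R: "wcausal R" and M0: "\<And>w. M w 0 = p" and
    M: "\<And>w i. wordin Sg w \<Longrightarrow> R w i \<in> D \<and> src (R w i) = M w i \<and> lbl (R w i) = w i \<and> M w (Suc i) = tgt (R w i)"
    by metis
  have "st p (R w) i = M w i" if "wordin Sg w" for w i
    using M[OF that] M0 by (cases i) auto
  then have "runf D p w (R w)" if "wordin Sg w" for w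
    using M that by (auto simp: runf_def)
  with R show ?thesis using that by blast
qed

text \<open>Domination yields strategies of every delay \<open>K\<close>. If Adam can force each
  block within \<open>K\<close> letters, he may thus choose the token's path through a block after
  all its letters are known.\<close>

lemma lookahead_blocks:
  assumes I: "(p0, x0) \<in> I" "\<And>p x. (p, x) \<in> I \<Longrightarrow> p \<in> V \<and> x \<in> V \<and> cls p = cls x" and ne: "Sg \<noteq> {}"
    and fc: "\<And>p x k. (p, x) \<in> I \<Longrightarrow> force (\<lambda>h. h \<noteq> [] \<and> (\<exists>xs. is_path D x xs \<and> map lbl xs = map lbl h \<and>
        (endst p h, endst x xs) \<in> I \<and> Q k h xs)) K [] p"
  shows "\<exists>w x r T. wordin Sg w \<and> runf D x0 w x \<and> runf D p0 w r \<and> (acc x \<longrightarrow> acc r) \<and>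
    T 0 = (0::nat) \<and> strict_mono T \<and> (\<forall>k. Q k (map r [T k..<T (Suc k)]) (map x [T k..<T (Suc k)]))"
proof -
  have pV: "p0 \<in> V" "x0 \<in> V" "cls p0 = cls x0" using I by auto
  obtain F where F: "delayed (Suc K) F" "\<And>w t. wordin Sg w \<Longrightarrow> runf D p0 w (F w t)"
     "\<And>w t. wordin Sg w \<Longrightarrow> runf D x0 w t \<Longrightarrow> acc t \<Longrightarrow> acc (F w t)"
    using dom_lookahead[OF cls_dom[OF pV(1,1) refl] cls_dom[OF pV], of K] by blast
  obtain a where "a \<in> Sg" using ne by blast
  then have "wordin Sg (\<lambda>_. a)" by (simp add: wordin_def)
  from blocks[OF delayed_mono[OF F(1) le_SucI[OF order_refl]] F(2) I(1) this, of Q] fc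
  obtain w x T where "wordin Sg w" "runf D x0 w x" "T 0 = 0" "strict_mono T"
     "\<forall>k. Q k (map (F w x) [T k..<T (Suc k)]) (map x [T k..<T (Suc k)])" by blast
  then show ?thesis using F by (intro exI[of _ w] exI[of _ x] exI[of _ "F w x"] exI[of _ T]) blast
qed

end

section \<open>Generalised Buchi acceptance\<close>

locale buchi_arena = arena D Sg acc V cls
  for D :: "('s,'a) trans set" and Sg :: "'a set" and acc :: "(nat \<Rightarrow> ('s,'a) trans) \<Rightarrow> bool"
    and V :: "'s set" and cls :: "'s \<Rightarrow> 'k" +
  fixes co :: "('s,'a) trans \<Rightarrow> 'c set" and C :: "'c set"
  assumes acc_buchi: "acc r \<longleftrightarrow> gen_buchi C (\<lambda>i. co (r i))" and finite_C: "finite C"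
begin

section \<open>Events and ranks\<close>

definition evt :: "'s \<Rightarrow> 'a list \<Rightarrow> bool" where
  "evt v u \<longleftrightarrow> (\<forall>q\<in>V. cls q = cls v \<longrightarrow> (\<exists>xs. is_path D q xs \<and> map lbl xs = u \<and> C \<subseteq> \<Union>(co ` set xs)))"

text \<open>Adam's goal for one block: an event during which Eve does not see \<open>c\<close> and
  after which she is outside \<open>Z\<close>.\<close>

definition miss :: "'c \<Rightarrow> 's set \<Rightarrow> 's \<Rightarrow> ('s,'a) trans list \<Rightarrow> bool" where
  "miss c Z v h \<longleftrightarrow> h \<noteq> [] \<and> (\<forall>t\<in>set h. c \<notin> co t) \<and> evt v (map lbl h) \<and> endst v h \<notin> Z"

text \<open>From \<open>rank c (Suc N)\<close> Eve can ensure that the first event without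
  \<open>c\<close>, if there is one, ends in \<open>rank c N\<close>. The rank bounds the number of
  events that pass before she sees \<open>c\<close>.\<close>

primrec rank :: "'c \<Rightarrow> nat \<Rightarrow> 's set" where
  "rank c 0 = {}"
| "rank c (Suc N) = {p \<in> V. \<forall>n. \<not> force (miss c (rank c N) p) n [] p}"

lemma rank_Suc: "rank c N \<subseteq> rank c (Suc N)"
proof (induction N)
  case (Suc N)
  have "miss c (rank c (Suc N)) p h \<Longrightarrow> miss c (rank c N) p h" for p h
    using Suc unfolding miss_def by blast
  then have "force (miss c (rank c (Suc N)) p) n [] p \<Longrightarrow> force (miss c (rank c N) p) n [] p" for p n
    using force_weaken[of "miss c (rank c (Suc N)) p" n "[]" p "miss c (rank c N) p"] by simp
  then show ?case unfolding rank.simps(2)[of c "Suc N"] unfolding rank.simps(2)[of c N] by blast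
qed simp

lemma rank_mono: "N \<le> M \<Longrightarrow> rank c N \<subseteq> rank c M"
  by (rule lift_Suc_mono_le[of "rank c"]) (rule rank_Suc)

text \<open>The ranks stabilise at a set \<open>U\<close>. Outside \<open>U\<close>, Adam forces
  within a common bound \<open>K\<close> an event without \<open>c\<close> that ends outside
  \<open>U\<close> again. A lookahead token in the same class takes the path with all colours in
  each block and accepts, while Eve never sees \<open>c\<close>; this contradicts
  domination.\<close>

lemma rank_exhaust:
  assumes p: "p \<in> V" and c: "c \<in> C" and ne: "Sg \<noteq> {}"
  shows "\<exists>N. p \<in> rank c N"
proof (rule ccontr)
  assume no: "\<not> ?thesis"
  define U where "U = (\<Union>N. rank c N)"
  have UV: "U \<subseteq> V"
  proof
    fix q assume "q \<in> U"
    then obtain N where "q \<in> rank c N" by (auto simp: U_def)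
    then show "q \<in> V" by (cases N) auto
  qed
  have "\<exists>n. \<forall>a\<in>U. \<forall>m\<ge>n. a \<in> rank c m"
  proof (rule uniform_bound)
    show "finite U" using UV finite_V finite_subset by blast
    fix a assume "a \<in> U"
    then show "\<exists>n. \<forall>m\<ge>n. a \<in> rank c m" unfolding U_def using rank_mono by blast
  qed
  then obtain N where N: "U = rank c N" by (auto simp: U_def)
  have "\<exists>K. \<forall>a\<in>V - U. \<forall>m\<ge>K. force (miss c U a) m [] a"
  proof (rule uniform_bound)
    fix a assume a: "a \<in> V - U"
    then have "a \<notin> rank c (Suc N)" unfolding U_def by blast
    then obtain n where "force (miss c U a) n [] a" using a N by auto
    then show "\<exists>n. \<forall>m\<ge>n. force (miss c U a) m [] a" using force_mono by blast
  qed (use finite_V in simp)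
  then obtain K where K: "\<And>a. a \<in> V - U \<Longrightarrow> force (miss c U a) K [] a" by auto
  define I where "I = {(q, x). q \<in> V - U \<and> x \<in> V \<and> cls q = cls x}"
  define Q where "Q = (\<lambda>(k::nat) h xs. (\<forall>t\<in>set h. c \<notin> co t) \<and> C \<subseteq> \<Union>(co ` set xs))"
  have fc: "force (\<lambda>h. h \<noteq> [] \<and> (\<exists>xs. is_path D x xs \<and> map lbl xs = map lbl h \<and>
        (endst q h, endst x xs) \<in> I \<and> Q k h xs)) K [] q" if I: "(q, x) \<in> I" for q x k
  proof -
    have q: "q \<in> V" "q \<notin> U" "x \<in> V" "cls x = cls q" using I by (auto simp: I_def)
    have "force (\<lambda>h. miss c U q h \<and> is_path D q h) K [] q"
      using force_path[of q "[]" "miss c U q" K] K q by simp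
    then show ?thesis
    proof (rule force_weaken)
      fix h assume h: "miss c U q h \<and> is_path D q h"
      then obtain xs where xs: "is_path D x xs" "map lbl xs = map lbl h" "C \<subseteq> \<Union>(co ` set xs)"
        using q unfolding miss_def evt_def by blast
      have "(endst q h, endst x xs) \<in> I"
        using h q path_V xs path_cls[of q h x xs] unfolding I_def miss_def by auto
      then show "h \<noteq> [] \<and> (\<exists>xs. is_path D x xs \<and> map lbl xs = map lbl h \<and> (endst q h, endst x xs) \<in> I \<and> Q k h xs)"
        using h xs unfolding Q_def miss_def by blast
    qed
  qed
  have I0: "(p, p) \<in> I" using no p by (auto simp: I_def U_def)
  have IV: "q \<in> V \<and> x \<in> V \<and> cls q = cls x" if "(q, x) \<in> I" for q x
    using that by (simp add: I_def)
  obtain w x r T where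
    r: "acc x \<longrightarrow> acc r" "T 0 = (0::nat)" "strict_mono T"
    and Q: "\<And>k. Q k (map r [T k..<T (Suc k)]) (map x [T k..<T (Suc k)])"
    using lookahead_blocks[where Q = Q and K = K, OF I0 IV ne fc] by blast
  have "acc x" unfolding acc_buchi gen_buchi_def INFM_nat_le
  proof (intro ballI allI)
    fix d m assume "d \<in> C"
    then obtain i where "T m \<le> i" "d \<in> co (x i)" using Q[of m] unfolding Q_def by fastforce
    moreover have "m \<le> T m" using r(3) by (rule strict_mono_imp_increasing)
    ultimately show "\<exists>i\<ge>m. d \<in> co (x i)" by (meson le_trans)
  qed
  then obtain i where i: "c \<in> co (r i)"
    using r(1) c unfolding acc_buchi gen_buchi_def INFM_nat_le by blast
  obtain k where "T k \<le> i" "i < T (Suc k)" using strict_mono_block[OF r(3,2)] by blast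
  then show False using Q[of k] i unfolding Q_def by auto
qed

text \<open>Domination gives every state of the class an accepting run on \<open>w\<close>. As there
  are finitely many states and colours, some prefix length suffices for all of them.\<close>

lemma evt_eventually:
  assumes v: "v \<in> V" and q: "q \<in> V" "cls q = cls v" and w: "wordin Sg w" and r: "runf D q w r" "acc r"
  shows "\<exists>n. \<forall>m\<ge>n. evt v (map w [0..<m])"
proof -
  have "\<exists>n. \<forall>y\<in>{y \<in> V. cls y = cls v}. \<forall>m\<ge>n.
      \<exists>xs. is_path D y xs \<and> map lbl xs = map w [0..<m] \<and> C \<subseteq> \<Union>(co ` set xs)"
  proof (rule uniform_bound)
    fix y assume "y \<in> {y \<in> V. cls y = cls v}"
    then obtain s where s: "runf D y w s" "acc s"
      using acc_transfer[OF _ q(1) _ w r] q by auto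
    have "\<exists>n. \<forall>d\<in>C. \<forall>m\<ge>n. \<exists>i<m. d \<in> co (s i)"
    proof (rule uniform_bound[OF finite_C])
      fix d assume "d \<in> C"
      then obtain i where "d \<in> co (s i)" using s(2) unfolding acc_buchi gen_buchi_def INFM_nat_le by blast
      then show "\<exists>n. \<forall>m\<ge>n. \<exists>i<m. d \<in> co (s i)" by (intro exI[of _ "Suc i"]) (auto simp: less_eq_Suc_le)
    qed
    then obtain n where n: "\<And>d m. d \<in> C \<Longrightarrow> n \<le> m \<Longrightarrow> \<exists>i<m. d \<in> co (s i)" by blast
    show "\<exists>n. \<forall>m\<ge>n. \<exists>xs. is_path D y xs \<and> map lbl xs = map w [0..<m] \<and> C \<subseteq> \<Union>(co ` set xs)"
    proof (intro exI allI impI conjI)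
      fix m assume m: "n \<le> m"
      show "is_path D y (map s [0..<m])" "map lbl (map s [0..<m]) = map w [0..<m]"
        using runf_is_path[OF s(1), of 0 m] by simp_all
      show "C \<subseteq> \<Union>(co ` set (map s [0..<m]))" using n[OF _ m] by fastforce
    qed
  qed (use finite_V in simp)
  then obtain n where n: "\<And>y m. y \<in> V \<Longrightarrow> cls y = cls v \<Longrightarrow> n \<le> m \<Longrightarrow>
      \<exists>xs. is_path D y xs \<and> map lbl xs = map w [0..<m] \<and> C \<subseteq> \<Union>(co ` set xs)" by blast
  then show ?thesis unfolding evt_def by blast
qed

text \<open>In \<open>(j, N, v, h)\<close>, Eve seeks the colour \<open>e j\<close>, the current
  block starts in \<open>v\<close> with moves \<open>h\<close> so far, and an event closing the
  block has to end in rank \<open>N\<close>.\<close>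

definition cfg_inv :: "(nat \<Rightarrow> 'c) \<Rightarrow> nat \<times> nat \<times> 's \<times> ('s,'a) trans list \<Rightarrow> bool" where
  "cfg_inv e m \<longleftrightarrow> (case m of (j, N, v, h) \<Rightarrow> v \<in> V \<and> is_path D v h \<and> (\<forall>t\<in>set h. e j \<notin> co t) \<and>
     (\<forall>n. \<not> force (miss (e j) (rank (e j) N) v) n h (endst v h)))"

text \<open>Either the sought colour appears and the next one is sought with a fresh rank, or an
  event without it closes the block and lowers \<open>N\<close>, or the block grows.\<close>

definition cfg_step :: "(nat \<Rightarrow> 'c) \<Rightarrow> nat \<times> nat \<times> 's \<times> ('s,'a) trans list \<Rightarrow> 'a \<Rightarrow> ('s,'a) trans \<Rightarrow>
    nat \<times> nat \<times> 's \<times> ('s,'a) trans list \<Rightarrow> bool" where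
  "cfg_step e m a t m' \<longleftrightarrow> (case m of (j, N, v, h) \<Rightarrow> t \<in> D \<and> src t = endst v h \<and> lbl t = a \<and>
     (e j \<in> co t \<and> (\<exists>N'. m' = (Suc j, N', tgt t, [])) \<or>
      e j \<notin> co t \<and> evt v (map lbl (h @ [t])) \<and> (\<exists>N'. N = Suc N' \<and> m' = (j, N', tgt t, [])) \<or>
      e j \<notin> co t \<and> \<not> evt v (map lbl (h @ [t])) \<and> m' = (j, N, v, h @ [t])))"

lemma cfg_inv_start:
  assumes "p \<in> V" "e j \<in> C" "Sg \<noteq> {}"
  shows "\<exists>N. cfg_inv e (j, N, p, [])"
proof -
  obtain M where M: "p \<in> rank (e j) M" using rank_exhaust assms by blast
  then obtain N where "M = Suc N" by (cases M) auto
  then show ?thesis using M assms by (auto simp: cfg_inv_def)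
qed

lemma cfg_step_ex:
  assumes e: "\<And>j. e j \<in> C" and ne: "Sg \<noteq> {}" and inv: "cfg_inv e m" and a: "a \<in> Sg"
  shows "\<exists>t m'. cfg_step e m a t m' \<and> cfg_inv e m'"
proof -
  obtain j N v h where m: "m = (j, N, v, h)" by (cases m)
  have i: "v \<in> V" "is_path D v h" "\<forall>t\<in>set h. e j \<notin> co t"
     "\<And>n. \<not> force (miss (e j) (rank (e j) N) v) n h (endst v h)"
    using inv by (auto simp: cfg_inv_def m)
  obtain p' where p': "(endst v h, a, p') \<in> D"
     "\<And>n. \<not> force (miss (e j) (rank (e j) N) v) n (h @ [(endst v h, a, p')]) p'"
    using not_force_step[OF finite_D i(4) a] by blast
  define t where "t = (endst v h, a, p')"
  have t: "t \<in> D" "src t = endst v h" "lbl t = a" "tgt t = p'" using p' by (auto simp: t_def)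
  have p'V: "p' \<in> V" using D_V[OF t(1)] t by simp
  consider "e j \<in> co t" | "e j \<notin> co t" "evt v (map lbl (h @ [t]))" | "e j \<notin> co t" "\<not> evt v (map lbl (h @ [t]))"
    by blast
  then show ?thesis
  proof cases
    case 1
    obtain N' where "cfg_inv e (Suc j, N', p', [])" using cfg_inv_start[where e = e and j = "Suc j", OF p'V e ne] by blast
    then show ?thesis using 1 t by (intro exI[of _ t] exI[of _ "(Suc j, N', p', [])"]) (auto simp: cfg_step_def m)
  next
    case 2
    \<comment> \<open>Bound 0 says that the history itself is no miss. Being an event without the
      colour, it ends in the rank, which is nonempty and so has a positive index.\<close>
    have "\<not> miss (e j) (rank (e j) N) v (h @ [t])" using p'(2)[of 0] by (simp add: t_def)
    then have "p' \<in> rank (e j) N" using 2 i(3) t by (auto simp: miss_def)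
    then obtain N' where N': "N = Suc N'" "p' \<in> rank (e j) (Suc N')" by (cases N) auto
    then have "cfg_inv e (j, N', p', [])" by (auto simp: cfg_inv_def)
    then show ?thesis using 2 t N' by (intro exI[of _ t] exI[of _ "(j, N', p', [])"]) (auto simp: cfg_step_def m)
  next
    case 3
    have "cfg_inv e (j, N, v, h @ [t])" using i t 3 p'(2) by (auto simp: cfg_inv_def t_def)
    then show ?thesis using 3 t by (intro exI[of _ t] exI[of _ "(j, N, v, h @ [t])"]) (auto simp: cfg_step_def m)
  qed
qed

text \<open>Eve seeks the colours cyclically. On an accepted word every block closes, and closing it
  by an event without the sought colour lowers \<open>N\<close>; so each sought colour appears and
  the next one follows.\<close>

theorem buchi_resolvable:
  assumes p0: "p0 \<in> V" and ne: "Sg \<noteq> {}"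
  shows "resolvable p0"
proof (cases "C = {}")
  case True
  obtain R where "wcausal R" "\<And>w. wordin Sg w \<Longrightarrow> runf D p0 w (R w)" using default_run[OF p0] by blast
  moreover have "acc r" for r using True by (simp add: acc_buchi gen_buchi_def)
  ultimately show ?thesis unfolding resolvable_def by blast
next
  case False
  obtain e where e: "\<And>j. e j \<in> C" "\<And>c n. c \<in> C \<Longrightarrow> \<exists>j\<ge>n::nat. e j = c"
    using cyclic_enumeration[OF finite_C False] by blast
  obtain N0 where N0: "cfg_inv e (0, N0, p0, [])" using cfg_inv_start[where e = e and j = 0, OF p0 e(1) ne] by blast
  obtain R M where R: "wcausal R" and M0: "\<And>w. M w 0 = (0, N0, p0, [])" and
    M: "\<And>w i. wordin Sg w \<Longrightarrow> cfg_inv e (M w i) \<and> cfg_step e (M w i) (w i) (R w i) (M w (Suc i))"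
    by (rule machine[where Inv = "cfg_inv e" and Sg = Sg and step = "cfg_step e", OF N0 cfg_step_ex[OF e(1) ne]]) blast+
  have "runf D p0 w (R w) \<and> ((\<exists>r. runf D p0 w r \<and> acc r) \<longrightarrow> acc (R w))" if w: "wordin Sg w" for w
  proof -
    define J N v h where "J i = fst (M w i)" and "N i = fst (snd (M w i))" and
      "v i = fst (snd (snd (M w i)))" and "h i = snd (snd (snd (M w i)))" for i
    have Mi: "M w i = (J i, N i, v i, h i)" for i by (simp add: J_def N_def v_def h_def)
    define hit where "hit i \<longleftrightarrow> e (J i) \<in> co (R w i)" for i
    have init0: "J 0 = 0" "v 0 = p0" "h 0 = []" by (auto simp: J_def v_def h_def M0)
    have legal: "R w i \<in> D" "src (R w i) = endst (v i) (h i)" "lbl (R w i) = w i" for i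
      using M[OF w, of i] by (auto simp: cfg_step_def Mi)
    define E where "E i \<longleftrightarrow> evt (v i) (map lbl (h i @ [R w i]))" for i
    have hitD: "J (Suc i) = Suc (J i)" if "hit i" for i
      using M[OF w, of i] that unfolding cfg_step_def Mi hit_def by auto
    have nohitD: "J (Suc i) = J i" if "\<not> hit i" for i
      using M[OF w, of i] that unfolding cfg_step_def Mi hit_def by auto
    have resetD: "v (Suc i) = tgt (R w i) \<and> h (Suc i) = []" if "hit i \<or> E i" for i
      using M[OF w, of i] that unfolding cfg_step_def Mi hit_def E_def by auto
    have evtD: "N (Suc i) < N i" if "\<not> hit i" "E i" for i
      using M[OF w, of i] that unfolding cfg_step_def Mi hit_def E_def by auto
    have contD: "N (Suc i) = N i \<and> v (Suc i) = v i \<and> h (Suc i) = h i @ [R w i]" if "\<not> hit i" "\<not> E i" for i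
      using M[OF w, of i] that unfolding cfg_step_def Mi hit_def E_def by auto
    have pos: "endst (v i) (h i) = st p0 (R w) i" for i
    proof (induction i)
      case (Suc i)
      show ?case using resetD[of i] contD[of i] by (cases "hit i \<or> E i") auto
    qed (simp add: init0)
    have run: "runf D p0 w (R w)" using legal pos by (auto simp: runf_def)
    \<comment> \<open>The current block started at time \<open>i - length (h i)\<close>, and
      \<open>h i\<close> reads the letters since then.\<close>
    have loc: "length (h i) \<le> i \<and> v i = st p0 (R w) (i - length (h i)) \<and> map lbl (h i) = map w [i - length (h i)..<i]" for i
    proof (induction i)
      case (Suc i)
      show ?case
      proof (cases "hit i \<or> E i")
        case True
        then show ?thesis using resetD[of i] by auto
      next
        case False
        then show ?thesis using contD[of i] Suc legal(3)[of i] by (auto simp: Suc_diff_le)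
      qed
    qed (simp add: init0)
    have "acc (R w)" if r: "runf D p0 w r" "acc r" for r
    proof -
      \<comment> \<open>A block that never closes has a fixed start \<open>s\<close>. There the
        accepting run \<open>r\<close> is in an equivalent state, so long enough prefixes of the
        remaining word are events.\<close>
      have ev: "\<exists>i'\<ge>i. hit i' \<or> E i'" for i
      proof (rule ccontr)
        assume no: "\<not> ?thesis"
        define s where "s = i - length (h i)"
        have li: "length (h i) \<le> i" using loc by blast
        have c: "v (i + d) = v i \<and> length (h (i + d)) = length (h i) + d" for d
        proof (induction d)
          case (Suc d)
          have "\<not> hit (i + d) \<and> \<not> E (i + d)" using no by auto
          then show ?case using Suc contD[of "i + d"] by auto
        qed simp
        have vV: "v i \<in> V" and ri: "st p0 r s \<in> V" using loc[of i] run_V[OF run p0] run_V[OF r(1) p0] by auto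
        have "cls (st p0 r s) = cls (v i)"
          using run_cls[OF r(1) run refl] loc[of i] by (simp add: s_def)
        from evt_eventually[OF vV ri this wordin_shift[OF w] runf_shift[OF r(1)]] r(2)
        obtain n where n: "\<And>m. n \<le> m \<Longrightarrow> evt (v i) (map (\<lambda>k. w (s + k)) [0..<m])"
          using acc_shift[of r s] by blast
        have "map lbl (h (i + n) @ [R w (i + n)]) = map w [s..<Suc (i + n)]"
          using loc[of "i + n"] c[of n] li legal(3)[of "i + n"] by (simp add: s_def)
        also have "\<dots> = map (\<lambda>k. w (s + k)) [0..<Suc (i + n) - s]"
          by (rule nth_equalityI) (auto simp: s_def simp del: upt_Suc)
        finally have "evt (v (i + n)) (map lbl (h (i + n) @ [R w (i + n)]))"
          using n[of "Suc (i + n) - s"] c[of n] by (simp add: s_def)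
        then show False using no by (auto simp: E_def)
      qed
      have nxt: "\<exists>i'\<ge>i. hit i' \<and> J i' = J i" for i
      proof (rule ccontr)
        assume no: "\<not> ?thesis"
        have "J (i + d) = J i" for d
        proof (induction d)
          case (Suc d)
          then have "\<not> hit (i + d)" using no by auto
          then show ?case using Suc nohitD[of "i + d"] by simp
        qed simp
        then have nh: "\<not> hit i'" if "i' \<ge> i" for i'
          using no that by (metis le_add_diff_inverse)
        show False
        proof (rule nat_no_infinite_descent[of i N])
          fix k assume k: "k \<ge> i"
          show "N (Suc k) \<le> N k" using nh[OF k] evtD[of k] contD[of k] by (cases "E k") auto
          obtain k' where k': "k' \<ge> k" "hit k' \<or> E k'" using ev by blast
          then show "\<exists>k'\<ge>k. N (Suc k') < N k'" using nh[of k'] k evtD[of k'] by (intro exI[of _ k']) auto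
        qed
      qed
      have all: "\<exists>i\<ge>n. hit i \<and> J i = J n + d" for n d
      proof (induction d)
        case 0
        then show ?case using nxt[of n] by simp
      next
        case (Suc d)
        then obtain i where i: "i \<ge> n" "hit i" "J i = J n + d" by blast
        obtain i' where "i' \<ge> Suc i" "hit i'" "J i' = J (Suc i)" using nxt by blast
        then show ?case using i hitD[of i] by (intro exI[of _ i']) auto
      qed
      show ?thesis unfolding acc_buchi gen_buchi_def INFM_nat_le
      proof (intro ballI allI)
        fix c n assume "c \<in> C"
        then obtain j where j: "j \<ge> J n" "e j = c" using e(2) by blast
        obtain i where "i \<ge> n" "hit i" "J i = j" using all[of n "j - J n"] j by auto
        then show "\<exists>i\<ge>n. c \<in> co (R w i)" using j unfolding hit_def by auto
      qed
    qed
    then show ?thesis using run by blast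
  qed
  then show ?thesis using R unfolding resolvable_def by blast
qed

end

section \<open>Generalised coBuchi acceptance\<close>

context game
begin

text \<open>With her history as memory, Eve keeps \<open>P\<close> unforceable within any bound, by
  \<open>not_force_step\<close>. Bound 0 then says that \<open>P\<close> never holds.\<close>

lemma avoid_strategy:
  assumes fin: "finite D" and nf: "\<And>n. \<not> force P n [] p"
  shows "\<exists>Y. wcausal Y \<and> (\<forall>w. wordin Sg w \<longrightarrow> runf D p w (Y w) \<and> (\<forall>n. \<not> P (map (Y w) [0..<n])))"
proof -
  define inv where "inv h \<longleftrightarrow> (\<forall>n. \<not> force P n h (endst p h))" for h
  define stp where "stp h a t h' \<longleftrightarrow> t \<in> D \<and> src t = endst p h \<and> lbl t = a \<and> h' = h @ [t]" for h a t h'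
  have i0: "inv []" using nf by (simp add: inv_def)
  have ex: "\<exists>t h'. stp h a t h' \<and> inv h'" if "inv h" "a \<in> Sg" for h a
  proof -
    obtain p' where "(endst p h, a, p') \<in> D" "\<forall>n. \<not> force P n (h @ [(endst p h, a, p')]) p'"
      using not_force_step[OF fin, of P h "endst p h" a] \<open>inv h\<close> \<open>a \<in> Sg\<close> unfolding inv_def by blast
    then show ?thesis
      by (intro exI[of _ "(endst p h, a, p')"] exI[of _ "h @ [(endst p h, a, p')]"]) (auto simp: stp_def inv_def)
  qed
  obtain R M where R: "wcausal R" and M0: "\<And>w. M w 0 = []" and
    M: "\<And>w i. wordin Sg w \<Longrightarrow> inv (M w i) \<and> stp (M w i) (w i) (R w i) (M w (Suc i))"
    by (rule machine[where Inv = inv and Sg = Sg and step = stp, OF i0 ex]) blast+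
  have "runf D p w (R w) \<and> (\<forall>n. \<not> P (map (R w) [0..<n]))" if w: "wordin Sg w" for w
  proof -
    have Mw: "M w i = map (R w) [0..<i]" for i
    proof (induction i)
      case (Suc i)
      then show ?case using M[OF w, of i] by (simp add: stp_def)
    qed (simp add: M0)
    have "endst p (map (R w) [0..<i]) = st p (R w) i" for i
      using runp_endst[of 0 i p "R w"] by simp
    then have "runf D p w (R w)" using M[OF w] unfolding Mw by (auto simp: runf_def stp_def)
    moreover have "\<not> P (map (R w) [0..<n])" for n
      using M[OF w, of n] unfolding Mw inv_def by (metis force.simps(1))
    ultimately show ?thesis by blast
  qed
  then show ?thesis using R by blast
qed

lemma force_prefix:
  "force P n h2 p \<Longrightarrow> (\<And>h2. P h2 \<Longrightarrow> Q (h @ h2)) \<Longrightarrow> force Q n (h @ h2) p"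
proof (induction n arbitrary: h2 p)
  case (Suc n)
  show ?case
  proof (cases "P h2")
    case True
    then show ?thesis using Suc.prems by simp
  next
    case False
    then obtain a where a: "a \<in> Sg" "\<And>p'. (p, a, p') \<in> D \<Longrightarrow> force P n (h2 @ [(p, a, p')]) p'"
      using Suc.prems(1) by auto
    have "force Q n ((h @ h2) @ [(p, a, p')]) p'" if "(p, a, p') \<in> D" for p'
      using Suc.IH[OF a(2)[OF that] Suc.prems(2)] by simp
    then show ?thesis using a(1) unfolding force.simps(2) by blast
  qed
qed simp

end

lemma nat_mono_bounded_const:
  fixes f :: "nat \<Rightarrow> nat"
  assumes "\<And>t. f t \<le> f (Suc t)" "\<And>t. f t \<le> B"
  shows "\<exists>t1. \<forall>t\<ge>t1. f t = f t1"
proof -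
  have mono: "f s \<le> f t" if "s \<le> t" for s t using assms(1) that by (rule lift_Suc_mono_le)
  have fin: "finite (range f)" by (rule finite_subset[of _ "{..B}"]) (use assms(2) in auto)
  obtain t1 where t1: "f t1 = Max (range f)"
    using Max_in[OF fin] by fastforce
  have "f t \<le> f t1" for t unfolding t1 by (rule Max_ge[OF fin]) auto
  then show ?thesis using mono by (intro exI[of _ t1]) (auto intro: antisym)
qed

context arena
begin

text \<open>Eve chases the virtual run number \<open>\<iota> w t\<close>, restarting a one-token strategy from the
  current pair of states whenever this number changes.\<close>
lemma follow_runs:
  fixes \<iota> :: "(nat \<Rightarrow> 'a) \<Rightarrow> nat \<Rightarrow> nat" and S :: "nat \<Rightarrow> (nat \<Rightarrow> 'a) \<Rightarrow> nat \<Rightarrow> 's"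
    and Y :: "nat \<Rightarrow> (nat \<Rightarrow> 'a) \<Rightarrow> nat \<Rightarrow> ('s,'a) trans"
  assumes p0: "p0 \<in> V" and z: "\<And>w. wordin Sg w \<Longrightarrow> runf D p0 w (z w)"
    and cI: "\<And>w w' t. (\<And>j. j < t \<Longrightarrow> w j = w' j) \<Longrightarrow> \<iota> w t = \<iota> w' t"
    and cS: "\<And>i w w' t. (\<And>j. j < t \<Longrightarrow> w j = w' j) \<Longrightarrow> S i w t = S i w' t"
    and cY: "\<And>i. wcausal (Y i)"
    and valid: "\<And>w t. wordin Sg w \<Longrightarrow> S (\<iota> w t) w t \<in> V \<and> cls (S (\<iota> w t) w t) = cls (st p0 (z w) t) \<and>
       runf D (S (\<iota> w t) w t) (\<lambda>k. w (t + k)) (\<lambda>k. Y (\<iota> w t) w (t + k))"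
  shows "\<exists>R. wcausal R \<and> (\<forall>w. wordin Sg w \<longrightarrow> runf D p0 w (R w) \<and>
     (\<forall>i t1. (\<forall>t\<ge>t1. \<iota> w t = i) \<and> acc (Y i w) \<longrightarrow> acc (R w)))"
proof -
  \<comment> \<open>A map of delay 1 is chosen for every pair, dominating or not, so that causality
    can be shown without reference to domination.\<close>
  have "\<exists>F. delayed 1 F \<and> (dom p q \<longrightarrow> wins F p q)" for p q
  proof (cases "dom p q")
    case True
    then show ?thesis by (auto simp: dom_def wins_def)
  next
    case False
    then show ?thesis by (intro exI[of _ "\<lambda>_ _ _. undefined"]) (auto simp: delayed_def)
  qed
  then obtain G where G: "\<And>p q. delayed 1 (G p q)" "\<And>p q. dom p q \<Longrightarrow> wins (G p q) p q" by metis
  \<comment> \<open>\<open>c\<close> holds the time and Eve's state at the last restart; from there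
    she plays the one-token strategy against virtual run \<open>i\<close>.\<close>
  define rr where "rr w c i = G (snd c) (S i w (fst c)) (\<lambda>k. w (fst c + k)) (\<lambda>k. Y i w (fst c + k))"
    for w :: "nat \<Rightarrow> 'a" and c :: "nat \<times> 's" and i
  define stp where "stp w c i t = st (snd c) (rr w c i) (t - fst c)" for w :: "nat \<Rightarrow> 'a" and c i t
  define cfg where "cfg w t = rec_nat (0, p0) (\<lambda>t c. if \<iota> w (Suc t) = \<iota> w t then c else (Suc t, stp w c (\<iota> w t) (Suc t))) t"
    for w :: "nat \<Rightarrow> 'a" and t
  have cfg0: "cfg w 0 = (0, p0)" and cfgS: "cfg w (Suc t) =
     (if \<iota> w (Suc t) = \<iota> w t then cfg w t else (Suc t, stp w (cfg w t) (\<iota> w t) (Suc t)))" for w t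
    by (auto simp: cfg_def)
  define R where "R w t = rr w (cfg w t) (\<iota> w t) (t - fst (cfg w t))" for w :: "nat \<Rightarrow> 'a" and t
  have le: "fst (cfg w t) \<le> t" for w t
    by (induction t) (auto simp: cfg0 cfgS)
  have rrc: "rr w c i k = rr w' c i k" if "\<And>j. j \<le> fst c + k \<Longrightarrow> w j = w' j" for w w' c i k
  proof -
    have "S i w (fst c) = S i w' (fst c)" by (rule cS) (use that in auto)
    moreover have "G p q (\<lambda>k. w (fst c + k)) (\<lambda>k. Y i w (fst c + k)) k = G p q (\<lambda>k. w' (fst c + k)) (\<lambda>k. Y i w' (fst c + k)) k" for p q
    proof (rule delayedD[OF G(1)])
      fix j assume "j + 1 \<le> k"
      then show "Y i w (fst c + j) = Y i w' (fst c + j)" by (intro wcausalD[OF cY] that) auto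
    qed (use that in auto)
    ultimately show ?thesis unfolding rr_def by simp
  qed
  have cfgc: "cfg w t = cfg w' t" if "\<And>j. j < t \<Longrightarrow> w j = w' j" for w w' t
    using that
  proof (induction t)
    case (Suc t)
    have 1: "cfg w t = cfg w' t" using Suc by auto
    have 2: "\<iota> w t = \<iota> w' t" "\<iota> w (Suc t) = \<iota> w' (Suc t)"
      by (rule cI, use Suc.prems in auto)+
    have "stp w (cfg w t) (\<iota> w t) (Suc t) = stp w' (cfg w t) (\<iota> w t) (Suc t)"
      unfolding stp_def by (rule st_cong, rule rrc) (use Suc.prems le[of w t] in auto)
    then show ?case unfolding cfgS 1 2 by simp
  qed (simp add: cfg0)
  have Rc: "wcausal R" unfolding wcausal_def
  proof (intro allI impI)
    fix w w' :: "nat \<Rightarrow> 'a" and i assume a: "\<forall>j\<le>i. w j = w' j"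
    have 1: "cfg w i = cfg w' i" by (rule cfgc) (use a in auto)
    have 2: "\<iota> w i = \<iota> w' i" by (rule cI) (use a in auto)
    show "R w i = R w' i" unfolding R_def 1 2 by (rule rrc) (use a le[of w' i] in auto)
  qed
  have "runf D p0 w (R w) \<and> (\<forall>i t1. (\<forall>t\<ge>t1. \<iota> w t = i) \<and> acc (Y i w) \<longrightarrow> acc (R w))" if w: "wordin Sg w" for w
  proof -
    \<comment> \<open>The class of the reference run \<open>z w\<close> at the restart shows that
      Eve's state and that of the virtual run were equivalent then.\<close>
    define ok where "ok c i \<longleftrightarrow> snd c \<in> V \<and> cls (snd c) = cls (st p0 (z w) (fst c)) \<and> \<iota> w (fst c) = i" for c i
    have win: "wins (G (snd c) (S i w (fst c))) (snd c) (S i w (fst c))" if "ok c i" for c i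
      using valid[OF w, of "fst c"] that by (intro G(2) cls_dom) (auto simp: ok_def)
    have rrun: "runf D (snd c) (\<lambda>k. w (fst c + k)) (rr w c i)" if "ok c i" for c i
      using win[OF that] wordin_shift[OF w] unfolding rr_def wins_def by blast
    have ok: "ok (cfg w t) (\<iota> w t)" for t
    proof (induction t)
      case 0
      then show ?case using p0 by (simp add: ok_def cfg0)
    next
      case (Suc t)
      show ?case
      proof (cases "\<iota> w (Suc t) = \<iota> w t")
        case True
        then show ?thesis using Suc by (simp add: cfgS)
      next
        case False
        let ?c = "cfg w t"
        have zc: "runf D (st p0 (z w) (fst ?c)) (\<lambda>k. w (fst ?c + k)) (\<lambda>k. z w (fst ?c + k))"
          by (rule runf_shift[OF z[OF w]])
        have "cls (stp w ?c (\<iota> w t) (Suc t)) = cls (st (st p0 (z w) (fst ?c)) (\<lambda>k. z w (fst ?c + k)) (Suc t - fst ?c))"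
          unfolding stp_def by (rule run_cls[OF rrun[OF Suc] zc]) (use Suc in \<open>simp add: ok_def\<close>)
        also have "\<dots> = cls (st p0 (z w) (Suc t))" using le[of w t] by (simp add: Suc_diff_le)
        finally have 1: "cls (stp w ?c (\<iota> w t) (Suc t)) = cls (st p0 (z w) (Suc t))" .
        have "stp w ?c (\<iota> w t) (Suc t) \<in> V"
          unfolding stp_def by (rule run_V[OF rrun[OF Suc]]) (use Suc in \<open>simp add: ok_def\<close>)
        then show ?thesis using False 1 by (simp add: cfgS ok_def)
      qed
    qed
    have pos: "st p0 (R w) t = stp w (cfg w t) (\<iota> w t) t" for t
    proof (cases t)
      case 0
      then show ?thesis by (simp add: stp_def cfg0)
    next
      case (Suc s)
      have "stp w (cfg w s) (\<iota> w s) (Suc s) = tgt (R w s)"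
        using le[of w s] by (simp add: stp_def R_def Suc_diff_le)
      then show ?thesis unfolding Suc cfgS by (auto simp: stp_def)
    qed
    have run: "runf D p0 w (R w)" unfolding runf_def
    proof
      fix t
      have "R w t \<in> D \<and> lbl (R w t) = w (fst (cfg w t) + (t - fst (cfg w t))) \<and> src (R w t) = stp w (cfg w t) (\<iota> w t) t"
        using rrun[OF ok[of t]] unfolding runf_def R_def stp_def by blast
      then show "R w t \<in> D \<and> lbl (R w t) = w t \<and> src (R w t) = st p0 (R w) t"
        using le[of w t] pos[of t] by simp
    qed
    have "acc (R w)" if i: "\<forall>t\<ge>t1. \<iota> w t = i" and a: "acc (Y i w)" for i t1
    proof -
      let ?c = "cfg w t1"
      \<comment> \<open>Once the number is constant there are no restarts, so a tail of
        \<open>R w\<close> is a tail of a single winning play.\<close>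
      have const: "cfg w (t1 + k) = ?c" for k
        by (induction k) (use i in \<open>auto simp: cfgS\<close>)
      have o: "ok ?c i" using ok[of t1] i by simp
      have "acc (\<lambda>k. Y i w (fst ?c + k))" using a acc_shift[of "Y i w" "fst ?c"] by blast
      moreover have "runf D (S i w (fst ?c)) (\<lambda>k. w (fst ?c + k)) (\<lambda>k. Y i w (fst ?c + k))"
        using valid[OF w, of "fst ?c"] o by (simp add: ok_def)
      ultimately have "acc (rr w ?c i)"
        using win[OF o] wordin_shift[OF w] unfolding rr_def wins_def by blast
      then have "acc (\<lambda>k. rr w ?c i ((t1 - fst ?c) + k))" using acc_shift[of "rr w ?c i" "t1 - fst ?c"] by blast
      moreover have "rr w ?c i ((t1 - fst ?c) + k) = R w (t1 + k)" for k
        unfolding R_def const using i le[of w t1] by simp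
      ultimately have "acc (\<lambda>k. R w (t1 + k))" by simp
      then show ?thesis using acc_shift[of "R w" t1] by blast
    qed
    then show ?thesis using run by blast
  qed
  then show ?thesis using Rc by blast
qed

end

locale cobuchi_arena = arena D Sg acc V cls
  for D :: "('s,'a) trans set" and Sg :: "'a set" and acc :: "(nat \<Rightarrow> ('s,'a) trans) \<Rightarrow> bool"
    and V :: "'s set" and cls :: "'s \<Rightarrow> 'k" +
  fixes co :: "('s,'a) trans \<Rightarrow> 'c set" and C :: "'c set"
  assumes acc_cobuchi: "acc r \<longleftrightarrow> gen_cobuchi C (\<lambda>i. co (r i))" and finite_C: "finite C"
begin

section \<open>Strongly connected components and covered states\<close>

definition safe_path :: "'c \<Rightarrow> 's \<Rightarrow> ('s,'a) trans list \<Rightarrow> bool" where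
  "safe_path c q xs \<longleftrightarrow> is_path D q xs \<and> (\<forall>t\<in>set xs. c \<notin> co t)"

definition sreach :: "'c \<Rightarrow> 's \<Rightarrow> 's set" where
  "sreach c q = {endst q xs | xs. safe_path c q xs}"

text \<open>The equality of reachable sets says that the path stays in a strongly connected component
  of the graph of transitions without \<open>c\<close>.\<close>
definition ipath :: "'c \<Rightarrow> 's \<Rightarrow> ('s,'a) trans list \<Rightarrow> bool" where
  "ipath c q xs \<longleftrightarrow> safe_path c q xs \<and> (\<forall>t\<in>set xs. sreach c (tgt t) = sreach c (src t))"

text \<open>Adam's goal: Eve has seen \<open>c'\<close> while \<open>q\<close> still has a run on
  the same letters inside its component.\<close>

definition bad :: "'c \<Rightarrow> 's \<Rightarrow> 'c \<Rightarrow> ('s,'a) trans list \<Rightarrow> bool" where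
  "bad c q c' h \<longleftrightarrow> (\<exists>t\<in>set h. c' \<in> co t) \<and> (\<exists>xs. ipath c q xs \<and> map lbl xs = map lbl h)"

definition covered :: "'c \<Rightarrow> 's \<Rightarrow> bool" where
  "covered c q \<longleftrightarrow> (\<exists>p\<in>V. cls p = cls q \<and> (\<exists>c'\<in>C. \<forall>n. \<not> force (bad c q c') n [] p))"

lemma safe_path_simps [simp]:
  "safe_path c q []" "safe_path c q (t # xs) \<longleftrightarrow> t \<in> D \<and> src t = q \<and> c \<notin> co t \<and> safe_path c (tgt t) xs"
  by (auto simp: safe_path_def)

lemma safe_path_append [simp]: "safe_path c q (xs @ ys) \<longleftrightarrow> safe_path c q xs \<and> safe_path c (endst q xs) ys"
  by (auto simp: safe_path_def)

lemma ipath_simps [simp]: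
  "ipath c q []" "ipath c q (t # xs) \<longleftrightarrow> t \<in> D \<and> src t = q \<and> c \<notin> co t \<and> sreach c (tgt t) = sreach c q \<and> ipath c (tgt t) xs"
  by (auto simp: ipath_def)

lemma ipath_append [simp]: "ipath c q (xs @ ys) \<longleftrightarrow> ipath c q xs \<and> ipath c (endst q xs) ys"
  by (auto simp: ipath_def)

lemma sreach_refl: "q \<in> sreach c q"
  unfolding sreach_def by (auto intro!: exI[of _ "[]"])

lemma sreach_mono: "safe_path c q xs \<Longrightarrow> sreach c (endst q xs) \<subseteq> sreach c q"
  unfolding sreach_def
proof clarify
  fix ys assume "safe_path c q xs" "safe_path c (endst q xs) ys"
  then have "safe_path c q (xs @ ys)" by simp
  then show "\<exists>zs. endst (endst q xs) ys = endst q zs \<and> safe_path c q zs"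
    by (intro exI[of _ "xs @ ys"]) simp
qed

lemma sreach_V: "q \<in> V \<Longrightarrow> sreach c q \<subseteq> V"
  unfolding sreach_def safe_path_def using path_V by auto

lemma ipath_sreach: "ipath c q xs \<Longrightarrow> sreach c (endst q xs) = sreach c q"
  by (induction xs arbitrary: q) auto

text \<open>Reachable sets only shrink along a safe path, so equality at its two ends forces
  equality in between.\<close>

lemma safe_path_ipath:
  "safe_path c q xs \<Longrightarrow> sreach c (endst q xs) = sreach c q \<Longrightarrow> ipath c q xs"
proof (induction xs arbitrary: q)
  case (Cons t xs)
  have "sreach c (endst (tgt t) xs) \<subseteq> sreach c (tgt t)" "sreach c (tgt t) \<subseteq> sreach c q"
    using Cons.prems sreach_mono[of c "tgt t" xs] sreach_mono[of c q "[t]"] by auto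
  then show ?case using Cons by auto
qed simp

text \<open>The witness \<open>p\<close> for \<open>q\<close> has a successor \<open>p'\<close> on
  the letter of \<open>t\<close> that keeps the goal unforceable. Prefixing \<open>t\<close> turns a
  bad history for \<open>tgt t\<close> into one for \<open>q\<close>, so \<open>p'\<close> is a
  witness for \<open>tgt t\<close>.\<close>

lemma covered_step:
  assumes cov: "covered c q" and t: "t \<in> D" "src t = q" "ipath c q [t]"
  shows "covered c (tgt t)"
proof -
  obtain p c' where p: "p \<in> V" "cls p = cls q" "c' \<in> C" "\<And>n. \<not> force (bad c q c') n [] p"
    using cov by (auto simp: covered_def)
  have "lbl t \<in> Sg" using D_V t by blast
  from not_force_step[OF finite_D p(4) this] obtain p' where
    p': "(p, lbl t, p') \<in> D" "\<And>n. \<not> force (bad c q c') n [(p, lbl t, p')] p'" by auto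
  have "\<not> force (bad c (tgt t) c') n [] p'" for n
  proof
    assume f: "force (bad c (tgt t) c') n [] p'"
    have "bad c q c' ([(p, lbl t, p')] @ h)" if "bad c (tgt t) c' h" for h
    proof -
      obtain xs where "ipath c (tgt t) xs" "map lbl xs = map lbl h" "\<exists>t\<in>set h. c' \<in> co t"
        using \<open>bad c (tgt t) c' h\<close> unfolding bad_def by blast
      then show ?thesis unfolding bad_def using t by (intro conjI exI[of _ "t # xs"]) auto
    qed
    then have "force (bad c q c') n ([(p, lbl t, p')] @ []) p'"
      using force_prefix[where Q = "bad c q c'" and h = "[(p, lbl t, p')]", OF f] by blast
    then show False using p'(2) by simp
  qed
  moreover have "cls p' = cls (tgt t)"
    using cls_step[OF p'(1), of q "tgt t"] t p(2) by (metis trans_collapse)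
  moreover have "p' \<in> V" using D_V[OF p'(1)] by simp
  ultimately show ?thesis using p(3) unfolding covered_def by blast
qed

lemma covered_path: "covered c q \<Longrightarrow> ipath c q xs \<Longrightarrow> covered c (endst q xs)"
proof (induction xs arbitrary: q)
  case (Cons t xs)
  then show ?case using covered_step[of c q t] by auto
qed simp

text \<open>Inside its component the path can be continued back to \<open>q\<close>, and being
  covered is passed on along this return path.\<close>

lemma covered_back:
  assumes "ipath c q xs" "covered c (endst q xs)"
  shows "covered c q"
proof -
  have eq: "sreach c (endst q xs) = sreach c q" using assms ipath_sreach by blast
  then have "q \<in> sreach c (endst q xs)" using sreach_refl by blast
  then obtain ys where ys: "safe_path c (endst q xs) ys" "endst (endst q xs) ys = q"
    unfolding sreach_def by auto
  then have "ipath c (endst q xs) ys" using safe_path_ipath eq by simp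
  from covered_path[OF assms(2) this] show ?thesis using ys by simp
qed

text \<open>From an uncovered state, Adam can force any colour on Eve while the token keeps a path
  inside its component, whose end is again uncovered by \<open>covered_back\<close>. Requesting the
  colours cyclically makes Eve reject, while the lookahead token never sees \<open>c\<close> and
  accepts.\<close>

lemma all_covered:
  assumes q: "q \<in> V" and c: "c \<in> C" and ne: "Sg \<noteq> {}"
  shows "covered c q"
proof (rule ccontr)
  assume no: "\<not> ?thesis"
  define I where "I = {(p, x). p \<in> V \<and> x \<in> V \<and> cls p = cls x \<and> \<not> covered c x}"
  obtain e where e: "\<And>j. e j \<in> C" "\<And>c n. c \<in> C \<Longrightarrow> \<exists>j\<ge>n::nat. e j = c"
    using cyclic_enumeration[OF finite_C] c by blast
  have "\<exists>K. \<forall>a\<in>I \<times> C. \<forall>m\<ge>K. force (bad c (snd (fst a)) (snd a)) m [] (fst (fst a))"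
  proof (rule uniform_bound)
    have "I \<subseteq> V \<times> V" by (auto simp: I_def)
    then show "finite (I \<times> C)" using finite_V finite_C by (meson finite_SigmaI finite_subset)
    fix a assume "a \<in> I \<times> C"
    then have "\<exists>n. force (bad c (snd (fst a)) (snd a)) n [] (fst (fst a))"
      unfolding I_def covered_def by auto
    then obtain n where "force (bad c (snd (fst a)) (snd a)) n [] (fst (fst a))" by blast
    then show "\<exists>n. \<forall>m\<ge>n. force (bad c (snd (fst a)) (snd a)) m [] (fst (fst a))" using force_mono by blast
  qed
  then obtain K where "\<forall>a\<in>I \<times> C. force (bad c (snd (fst a)) (snd a)) K [] (fst (fst a))" by blast
  then have K: "force (bad c x c') K [] p" if "(p, x) \<in> I" "c' \<in> C" for p x c'
    using that by (metis SigmaI fst_conv snd_conv)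
  define Q where "Q = (\<lambda>k h xs. (\<exists>t\<in>set h. e k \<in> co t) \<and> (\<forall>t\<in>set xs. c \<notin> co t))"
  have fc: "force (\<lambda>h. h \<noteq> [] \<and> (\<exists>xs. is_path D x xs \<and> map lbl xs = map lbl h \<and>
        (endst p h, endst x xs) \<in> I \<and> Q k h xs)) K [] p" if I: "(p, x) \<in> I" for p x k
  proof -
    have p: "p \<in> V" "x \<in> V" "cls p = cls x" "\<not> covered c x" using I by (auto simp: I_def)
    have "force (\<lambda>h. bad c x (e k) h \<and> is_path D p h) K [] p"
      using force_path[of p "[]" "bad c x (e k)" K] K[OF I e(1)] by simp
    then show ?thesis
    proof (rule force_weaken)
      fix h assume h: "bad c x (e k) h \<and> is_path D p h"
      then obtain xs where xs: "ipath c x xs" "map lbl xs = map lbl h" and hk: "\<exists>t\<in>set h. e k \<in> co t"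
        unfolding bad_def by blast
      then have px: "is_path D x xs" "\<forall>t\<in>set xs. c \<notin> co t" by (auto simp: ipath_def safe_path_def)
      have "(endst p h, endst x xs) \<in> I"
        using path_V h p px path_cls[of p h x xs] xs covered_back[OF xs(1)] by (auto simp: I_def)
      then show "h \<noteq> [] \<and> (\<exists>xs. is_path D x xs \<and> map lbl xs = map lbl h \<and> (endst p h, endst x xs) \<in> I \<and> Q k h xs)"
        using hk px xs unfolding Q_def by fastforce
    qed
  qed
  have I0: "(q, q) \<in> I" using no q by (auto simp: I_def)
  have IV: "p \<in> V \<and> x \<in> V \<and> cls p = cls x" if "(p, x) \<in> I" for p x
    using that by (simp add: I_def)
  obtain w x r T where
    r: "acc x \<longrightarrow> acc r" "T 0 = (0::nat)" "strict_mono T"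
    and Q: "\<And>k. Q k (map r [T k..<T (Suc k)]) (map x [T k..<T (Suc k)])"
    using lookahead_blocks[where Q = Q and K = K, OF I0 IV ne fc] by blast
  have "c \<notin> co (x i)" for i
  proof -
    obtain k where "T k \<le> i" "i < T (Suc k)" using strict_mono_block[OF r(3,2)] by blast
    then show ?thesis using Q[of k] unfolding Q_def by auto
  qed
  then have "acc x" unfolding acc_cobuchi gen_cobuchi_def using c by (intro bexI[of _ c]) simp_all
  then obtain c' where c': "c' \<in> C" "finite {i. c' \<in> co (r i)}"
    using r(1) by (auto simp: acc_cobuchi gen_cobuchi_def)
  have "infinite {i. c' \<in> co (r i)}" unfolding infinite_nat_iff_unbounded_le
  proof
    fix m
    obtain j where j: "j \<ge> m" "e j = c'" using e(2) c' by blast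
    obtain i where "T j \<le> i" "c' \<in> co (r i)" using Q[of j] j unfolding Q_def by auto
    moreover have "j \<le> T j" using r(3) by (rule strict_mono_imp_increasing)
    ultimately show "\<exists>n\<ge>m. n \<in> {i. c' \<in> co (r i)}" using j by (intro exI[of _ i]) auto
  qed
  then show False using c' by blast
qed


text \<open>After the last \<open>c\<close> the reachable sets decrease along the run; they are
  constant from a time of minimal cardinality on.\<close>

lemma eventually_internal:
  assumes q: "q \<in> V" and r: "runf D q w r" and fin: "finite {i. c \<in> co (r i)}"
  shows "\<exists>T. \<forall>m\<ge>T. ipath c (st q r T) (map r [T..<m])"
proof -
  obtain T0 where T0: "\<And>i. i \<ge> T0 \<Longrightarrow> c \<notin> co (r i)"
    using fin unfolding finite_nat_set_iff_bounded by (auto simp: not_less[symmetric])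
  define f where "f t = sreach c (st q r t)" for t
  have safe: "safe_path c (st q r s) (map r [s..<t])" if "T0 \<le> s" "s \<le> t" for s t
    using runf_is_path[OF r that(2)] T0 that unfolding safe_path_def by auto
  have dec: "f t \<subseteq> f s" if "T0 \<le> s" "s \<le> t" for s t
    using sreach_mono[OF safe[OF that]] runp_endst[OF that(2), of q r] by (simp add: f_def)
  have ff: "finite (f t)" for t
    using sreach_V[OF run_V[OF r q]] finite_V finite_subset unfolding f_def by blast
  obtain T where T: "T0 \<le> T" "\<And>t. T0 \<le> t \<Longrightarrow> card (f T) \<le> card (f t)"
    using ex_has_least_nat[of "\<lambda>t. T0 \<le> t" T0 "\<lambda>t. card (f t)"] by blast
  have eq: "f t = f T" if "T \<le> t" for t
    using card_seteq[OF ff dec[OF T(1) that]] T that by simp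
  have "ipath c (st q r T) (map r [T..<m])" if "T \<le> m" for m
  proof (rule safe_path_ipath)
    show "safe_path c (st q r T) (map r [T..<m])" using safe T that by blast
    show "sreach c (endst (st q r T) (map r [T..<m])) = sreach c (st q r T)"
      using eq[OF that] runp_endst[OF that, of q r] by (simp add: f_def)
  qed
  then show ?thesis by blast
qed

lemma cover_strategy:
  assumes "q \<in> V" "c \<in> C" "Sg \<noteq> {}"
  shows "\<exists>p c' Y. p \<in> V \<and> cls p = cls q \<and> c' \<in> C \<and> wcausal Y \<and>
    (\<forall>w. wordin Sg w \<longrightarrow> runf D p w (Y w) \<and> (\<forall>n. \<not> bad c q c' (map (Y w) [0..<n])))"
proof -
  obtain p c' where p: "p \<in> V" "cls p = cls q" "c' \<in> C" "\<And>n. \<not> force (bad c q c') n [] p"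
    using all_covered[OF assms] by (auto simp: covered_def)
  show ?thesis using avoid_strategy[OF finite_D p(4)] p(1-3) by blast
qed

text \<open>A thread is a starting time with a state and a colour; Eve chases the virtual run of the
  least thread alive. An accepting run eventually keeps one thread alive, which bounds the chased
  number. As the number never decreases, it settles, and the virtual run of that thread avoids a
  colour from its start on.\<close>

theorem cobuchi_resolvable:
  assumes p0: "p0 \<in> V" and ne: "Sg \<noteq> {}"
  shows "resolvable p0"
proof (cases "C = {}")
  case True
  obtain R where "wcausal R" "\<And>w. wordin Sg w \<Longrightarrow> runf D p0 w (R w)" using default_run[OF p0] by blast
  moreover have "\<not> acc r" for r using True by (simp add: acc_cobuchi gen_cobuchi_def)
  ultimately show ?thesis unfolding resolvable_def by blast
next
  case False
  obtain z where z: "wcausal z" "\<And>w. wordin Sg w \<Longrightarrow> runf D p0 w (z w)" using default_run[OF p0] by blast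
  have "\<exists>p c' Y. wcausal Y \<and> (x \<in> V \<times> C \<longrightarrow> p \<in> V \<and> cls p = cls (fst x) \<and> c' \<in> C \<and>
    (\<forall>w. wordin Sg w \<longrightarrow> runf D p w (Y w) \<and> (\<forall>n. \<not> bad (snd x) (fst x) c' (map (Y w) [0..<n]))))" for x
  proof (cases "x \<in> V \<times> C")
    case True
    then show ?thesis using cover_strategy[of "fst x" "snd x"] ne by (cases x) fastforce
  next
    case False
    then show ?thesis using z(1) by blast
  qed
  then obtain b d Yf where Yf: "\<And>x. wcausal (Yf x)" and
    cov: "\<And>x. x \<in> V \<times> C \<Longrightarrow> b x \<in> V \<and> cls (b x) = cls (fst x) \<and> d x \<in> C"
      "\<And>x w. x \<in> V \<times> C \<Longrightarrow> wordin Sg w \<Longrightarrow> runf D (b x) w (Yf x w)"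
      "\<And>x w n. x \<in> V \<times> C \<Longrightarrow> wordin Sg w \<Longrightarrow> \<not> bad (snd x) (fst x) (d x) (map (Yf x w) [0..<n])"
    by metis
  define N where "N = card (V \<times> C)"
  have finVC: "finite (V \<times> C)" using finite_V finite_C by simp
  obtain g where g: "bij_betw g {0..<N} (V \<times> C)" using ex_bij_betw_nat_finite[OF finVC] N_def by blast
  have Npos: "0 < N" unfolding N_def using finVC p0 False by (simp add: card_gt_0_iff) blast
  \<comment> \<open>Remainder and quotient by \<open>N\<close> code the pair and the starting time
    of thread \<open>i\<close>, so a later start has a larger number.\<close>
  define th where "th i = g (i mod N)" for i
  define s where "s i = i div N" for i
  have th: "th i \<in> V \<times> C" for i
    using g Npos unfolding th_def bij_betw_def by (metis atLeastLessThan_iff imageI mod_less_divisor zero_le)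
  have thread: "\<exists>i. s i = t \<and> th i = x" if x: "x \<in> V \<times> C" for t x
  proof -
    have "x \<in> g ` {0..<N}" using g x by (simp add: bij_betw_def)
    then obtain k where k: "k < N" "g k = x" by auto
    then show ?thesis by (intro exI[of _ "t * N + k"]) (auto simp: s_def th_def)
  qed
  define y where "y i w = Yf (th i) (\<lambda>k. w (s i + k))" for i and w :: "nat \<Rightarrow> 'a"
  \<comment> \<open>The values before \<open>s i\<close> are placeholders: only the part from
    \<open>s i\<close> on is chased, and acceptance ignores finitely many positions.\<close>
  define Y where "Y i w t = (if t < s i then undefined else y i w (t - s i))" for i and w :: "nat \<Rightarrow> 'a" and t
  define S where "S i w t = st (b (th i)) (y i w) (t - s i)" for i and w :: "nat \<Rightarrow> 'a" and t
  define alive where "alive w i t \<longleftrightarrow> s i \<le> t \<and> cls (fst (th i)) = cls (st p0 (z w) (s i)) \<and>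
    (\<exists>xs. ipath (snd (th i)) (fst (th i)) xs \<and> map lbl xs = map w [s i..<t])" for w :: "nat \<Rightarrow> 'a" and i t
  define \<iota> where "\<iota> w t = (LEAST i. alive w i t)" for w t
  have yc: "y i w k = y i w' k" if "\<And>j. j \<le> s i + k \<Longrightarrow> w j = w' j" for i w w' k
    unfolding y_def by (rule wcausalD[OF Yf]) (use that in auto)
  have cY: "wcausal (Y i)" for i
    unfolding wcausal_def Y_def by (auto intro: yc)
  have cS: "S i w t = S i w' t" if "\<And>j. j < t \<Longrightarrow> w j = w' j" for i w w' t
    unfolding S_def by (rule st_cong, rule yc) (use that in auto)
  have ca: "alive w i t \<longleftrightarrow> alive w' i t" if "\<And>j. j < t \<Longrightarrow> w j = w' j" for i w w' t
  proof (cases "s i \<le> t")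
    case True
    have "st p0 (z w) (s i) = st p0 (z w') (s i)"
      by (rule st_cong, rule wcausalD[OF z(1)]) (use that True in auto)
    moreover have "map w [s i..<t] = map w' [s i..<t]" using that by auto
    ultimately show ?thesis unfolding alive_def by (simp only:)
  qed (simp add: alive_def)
  have cI: "\<iota> w t = \<iota> w' t" if "\<And>j. j < t \<Longrightarrow> w j = w' j" for w w' t
    unfolding \<iota>_def using ca[OF that] by simp
  \<comment> \<open>The thread that starts at time \<open>t\<close> in the state of
    \<open>z w\<close> is alive through the empty path.\<close>
  have ex: "\<exists>i. alive w i t" if w: "wordin Sg w" for w t
  proof -
    obtain c where "c \<in> C" using False by blast
    then obtain i where "s i = t" "th i = (st p0 (z w) t, c)"
      using thread[of "(st p0 (z w) t, c)" t] run_V[OF z(2)[OF w] p0] by auto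
    then have "alive w i t" unfolding alive_def by (auto intro!: exI[of _ "[]"])
    then show ?thesis ..
  qed
  have al: "alive w (\<iota> w t) t" if "wordin Sg w" for w t
    unfolding \<iota>_def using ex[OF that] by (rule LeastI_ex)
  have yrun: "runf D (b (th i)) (\<lambda>k. w (s i + k)) (y i w)" if "wordin Sg w" for i w
    unfolding y_def using cov(2)[OF th wordin_shift[OF that]] .
  have valid: "S (\<iota> w t) w t \<in> V \<and> cls (S (\<iota> w t) w t) = cls (st p0 (z w) t) \<and>
       runf D (S (\<iota> w t) w t) (\<lambda>k. w (t + k)) (\<lambda>k. Y (\<iota> w t) w (t + k))" if w: "wordin Sg w" for w t
  proof -
    let ?i = "\<iota> w t"
    have le: "s ?i \<le> t" and cl: "cls (fst (th ?i)) = cls (st p0 (z w) (s ?i))"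
      using al[OF w] by (auto simp: alive_def)
    have V: "S ?i w t \<in> V" unfolding S_def using run_V[OF yrun[OF w]] cov(1)[OF th] by blast
    have zr: "runf D (st p0 (z w) (s ?i)) (\<lambda>k. w (s ?i + k)) (\<lambda>k. z w (s ?i + k))"
      by (rule runf_shift[OF z(2)[OF w]])
    have "cls (b (th ?i)) = cls (st p0 (z w) (s ?i))" using cl cov(1)[OF th] by simp
    from run_cls[OF yrun[OF w] zr this, of "t - s ?i"]
    have "cls (S ?i w t) = cls (st (st p0 (z w) (s ?i)) (\<lambda>k. z w (s ?i + k)) (t - s ?i))" by (simp add: S_def)
    also have "st (st p0 (z w) (s ?i)) (\<lambda>k. z w (s ?i + k)) (t - s ?i) = st p0 (z w) t"
      using le by (auto simp: st_def)
    finally have c: "cls (S ?i w t) = cls (st p0 (z w) t)" .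
    have "(\<lambda>k. w (s ?i + (t - s ?i + k))) = (\<lambda>k. w (t + k))" "(\<lambda>k. y ?i w (t - s ?i + k)) = (\<lambda>k. Y ?i w (t + k))"
      using le by (auto simp: Y_def fun_eq_iff)
    then have "runf D (S ?i w t) (\<lambda>k. w (t + k)) (\<lambda>k. Y ?i w (t + k))"
      using runf_shift[OF yrun[OF w], of ?i "t - s ?i"] by (simp add: S_def)
    then show ?thesis using V c by blast
  qed
  obtain R where R: "wcausal R" "\<And>w. wordin Sg w \<Longrightarrow> runf D p0 w (R w)"
    "\<And>w i t1. wordin Sg w \<Longrightarrow> \<forall>t\<ge>t1. \<iota> w t = i \<Longrightarrow> acc (Y i w) \<Longrightarrow> acc (R w)"
    using follow_runs[where \<iota> = \<iota> and S = S and Y = Y and z = z, OF p0 z(2) cI cS cY valid] by blast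
  have "acc (R w)" if w: "wordin Sg w" and r: "runf D p0 w r" "acc r" for w r
  proof -
    obtain c where c: "c \<in> C" "finite {i. c \<in> co (r i)}" using r(2) by (auto simp: acc_cobuchi gen_cobuchi_def)
    obtain T where T: "\<And>m. T \<le> m \<Longrightarrow> ipath c (st p0 r T) (map r [T..<m])"
      using eventually_internal[OF p0 r(1) c(2)] by blast
    obtain j where j: "s j = T" "th j = (st p0 r T, c)"
      using thread[of "(st p0 r T, c)" T] run_V[OF r(1) p0] c by auto
    have "alive w j t" if "T \<le> t" for t
      unfolding alive_def j using T[OF that] run_cls[OF r(1) z(2)[OF w] refl, of T] runf_is_path(2)[OF r(1) that] that
      by auto
    then have bd1: "\<iota> w t \<le> j" if "T \<le> t" for t unfolding \<iota>_def using that by (intro Least_le) auto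
    \<comment> \<open>A thread alive at \<open>Suc t\<close> that started by time \<open>t\<close>
      was alive at \<open>t\<close>, as dropping its last transition shows. A thread that starts
      later has a larger number.\<close>
    have inc: "\<iota> w t \<le> \<iota> w (Suc t)" for t
    proof (cases "s (\<iota> w (Suc t)) \<le> t")
      case True
      obtain xs where xs: "ipath (snd (th (\<iota> w (Suc t)))) (fst (th (\<iota> w (Suc t)))) xs"
        "map lbl xs = map w [s (\<iota> w (Suc t))..<Suc t]" and cl: "cls (fst (th (\<iota> w (Suc t)))) = cls (st p0 (z w) (s (\<iota> w (Suc t))))"
        using al[OF w, of "Suc t"] unfolding alive_def by blast
      have "xs \<noteq> []" using xs(2) True by auto
      then obtain ys l where ys: "xs = ys @ [l]" by (metis append_butlast_last_id)
      have "map lbl ys = map w [s (\<iota> w (Suc t))..<t]" using xs(2) True unfolding ys by simp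
      then have "alive w (\<iota> w (Suc t)) t" unfolding alive_def using True cl xs(1) ys by auto
      then show ?thesis unfolding \<iota>_def[of w t] by (rule Least_le)
    next
      case F: False
      have "s (\<iota> w t) \<le> t" using al[OF w, of t] by (simp add: alive_def)
      then have "s (\<iota> w t) < s (\<iota> w (Suc t))" using F by simp
      then show ?thesis unfolding s_def by (meson div_le_mono leD nat_le_linear)
    qed
    have bd: "\<iota> w t \<le> j" for t
    proof -
      have "\<iota> w t \<le> \<iota> w (t + T)" by (rule lift_Suc_mono_le[of "\<iota> w", OF inc]) simp
      then show ?thesis using bd1[of "t + T"] by simp
    qed
    obtain t1 where t1: "\<And>t. t \<ge> t1 \<Longrightarrow> \<iota> w t = \<iota> w t1"
      using nat_mono_bounded_const[of "\<iota> w" j, OF inc bd] by blast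
    let ?i = "\<iota> w t1"
    \<comment> \<open>If the virtual run saw its colour, the thread being alive afterwards would
      make the history bad, which the cover strategy excludes.\<close>
    have safe: "d (th ?i) \<notin> co (y ?i w k)" for k
    proof
      assume bad: "d (th ?i) \<in> co (y ?i w k)"
      define t where "t = max t1 (s ?i + Suc k)"
      have "alive w ?i t" using al[OF w, of t] t1[of t] by (simp add: t_def)
      then obtain xs where xs: "ipath (snd (th ?i)) (fst (th ?i)) xs" "map lbl xs = map w [s ?i..<t]"
        unfolding alive_def by blast
      have "map lbl (map (y ?i w) [0..<t - s ?i]) = map (\<lambda>k. w (s ?i + k)) [0..<t - s ?i]"
        using runf_is_path(2)[OF yrun[OF w], of 0 "t - s ?i" ?i] by simp
      also have "\<dots> = map w [s ?i..<t]" by (rule nth_equalityI) (auto simp: t_def)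
      finally have "bad (snd (th ?i)) (fst (th ?i)) (d (th ?i)) (map (y ?i w) [0..<t - s ?i])"
        unfolding bad_def using xs bad by (intro conjI exI[of _ xs] bexI[of _ "y ?i w k"]) (auto simp: t_def)
      then show False using cov(3)[OF th wordin_shift[OF w]] unfolding y_def by blast
    qed
    have "{k. d (th ?i) \<in> co (Y ?i w k)} \<subseteq> {..<s ?i}" using safe by (auto simp: Y_def split: if_splits)
    then have "finite {k. d (th ?i) \<in> co (Y ?i w k)}" using finite_subset by blast
    then have "acc (Y ?i w)" using cov(1)[OF th, of ?i] unfolding acc_cobuchi gen_cobuchi_def by blast
    then show ?thesis using R(3)[OF w, of t1 ?i] t1 by blast
  qed
  then show ?thesis using R(1,2) unfolding resolvable_def by blast
qed

end

section \<open>From the two-token game to an arena\<close>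

text \<open>A strategy that is only guaranteed to work as long as the opponent token moves legally can
  be continued arbitrarily inside \<open>V\<close> once that token has made an illegal move.\<close>
lemma repair:
  fixes S :: "(nat \<Rightarrow> 'a) \<Rightarrow> (nat \<Rightarrow> ('q,'a) trans) \<Rightarrow> nat \<Rightarrow> ('p,'a) trans"
  assumes tot: "\<And>p a. p \<in> V \<Longrightarrow> a \<in> Sg \<Longrightarrow> \<exists>t\<in>D'. src t = p \<and> lbl t = a \<and> tgt t \<in> V"
    and dS: "delayed 1 S"
    and leg: "\<And>w t n. wordin Sg w \<Longrightarrow> runp D q w t n \<Longrightarrow> runp D' p w (S w t) (Suc n) \<and> st p (S w t) (Suc n) \<in> V"
  shows "\<exists>F. delayed 1 F \<and> (\<forall>w t. wordin Sg w \<longrightarrow> runf D' p w (F w t) \<and> (runf D q w t \<longrightarrow> F w t = S w t))"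
proof -
  obtain pick where pick: "\<And>p a. p \<in> V \<Longrightarrow> a \<in> Sg \<Longrightarrow> pick p a \<in> D' \<and> src (pick p a) = p \<and> lbl (pick p a) = a \<and> tgt (pick p a) \<in> V"
    using tot by metis
  define F where "F w t i = rec_nat (S w t 0) (\<lambda>i u. if runp D q w t (Suc i) then S w t (Suc i) else pick (tgt u) (w (Suc i))) i" for w t i
  have F0: "F w t 0 = S w t 0" and FS: "F w t (Suc i) = (if runp D q w t (Suc i) then S w t (Suc i) else pick (tgt (F w t i)) (w (Suc i)))" for w t i
    by (auto simp: F_def)
  have FS': "F w t i = S w t i" if "runp D q w t i" for w t i
    using that by (cases i) (auto simp: F0 FS)
  have dF: "delayed 1 F" unfolding delayed_def
  proof (intro allI impI)
    fix w w' :: "nat \<Rightarrow> 'a" and t t' :: "nat \<Rightarrow> ('q,'a) trans" and i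
    assume "\<forall>j\<le>i. w j = w' j" "\<forall>j. j + 1 \<le> i \<longrightarrow> t j = t' j"
    then show "F w t i = F w' t' i"
    proof (induction i)
      case 0
      then show ?case unfolding F0 by (intro delayedD[OF dS]) auto
    next
      case (Suc i)
      have "S w t (Suc i) = S w' t' (Suc i)" by (rule delayedD[OF dS]) (use Suc.prems in auto)
      moreover have "runp D q w t (Suc i) \<longleftrightarrow> runp D q w' t' (Suc i)"
        by (rule runp_cong) (use Suc.prems in auto)
      moreover have "F w t i = F w' t' i" using Suc by auto
      ultimately show ?case using Suc.prems by (simp add: FS)
    qed
  qed
  have inv: "runp D' p w (F w t) (Suc i) \<and> tgt (F w t i) \<in> V" if w: "wordin Sg w" for w t i
  proof (induction i)
    case 0
    show ?case using leg[OF w, of t 0] by (simp add: runp_Suc F0)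
  next
    case (Suc i)
    show ?case
    proof (cases "runp D q w t (Suc i)")
      case True
      have eq: "F w t j = S w t j" if "j < Suc (Suc i)" for j
        using that by (intro FS' runp_mono[OF True]) auto
      have "runp D' p w (F w t) (Suc (Suc i)) \<longleftrightarrow> runp D' p w (S w t) (Suc (Suc i))"
        by (rule runp_cong) (use eq in auto)
      then show ?thesis using leg[OF w True] eq[of "Suc i"] by simp
    next
      case False
      have "w (Suc i) \<in> Sg" using w by (simp add: wordin_def)
      then show ?thesis using Suc pick[of "tgt (F w t i)" "w (Suc i)"] False by (simp add: runp_Suc[of _ _ _ _ "Suc i"] FS)
    qed
  qed
  have "runf D' p w (F w t)" if "wordin Sg w" for w t
    unfolding runf_iff using inv[OF that] runp_mono by (metis le_Suc_eq order_refl)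
  moreover have "F w t = S w t" if "runf D q w t" for w t
    using that FS' unfolding runf_iff by blast
  ultimately show ?thesis using dF by (intro exI[of _ F]) blast
qed

locale two_token = game D Sg acc
  for D :: "('s,'a) trans set" and Sg :: "'a set" and acc :: "(nat \<Rightarrow> ('s,'a) trans) \<Rightarrow> bool" +
  fixes Q :: "'s set" and q0 :: 's
    and T :: "(nat \<Rightarrow> 'a) \<Rightarrow> (nat \<Rightarrow> ('s,'a) trans) \<Rightarrow> (nat \<Rightarrow> ('s,'a) trans) \<Rightarrow> nat \<Rightarrow> ('s,'a) trans"
  assumes finite_Q: "finite Q" and finite_Sg: "finite Sg" and q0: "q0 \<in> Q" and D_Q: "D \<subseteq> Q \<times> Sg \<times> Q"
    and T_causal: "(\<And>j. j \<le> i \<Longrightarrow> w j = w' j) \<Longrightarrow> (\<And>j. j < i \<Longrightarrow> t1 j = t1' j) \<Longrightarrow> (\<And>j. j < i \<Longrightarrow> t2 j = t2' j)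
      \<Longrightarrow> T w t1 t2 i = T w' t1' t2' i"
    and T_legal: "wordin Sg w \<Longrightarrow> runp D q0 w t1 n \<Longrightarrow> runp D q0 w t2 n \<Longrightarrow> runp D q0 w (T w t1 t2) (Suc n)"
    and T_win: "wordin Sg w \<Longrightarrow> runf D q0 w t1 \<Longrightarrow> runf D q0 w t2 \<Longrightarrow> acc t1 \<or> acc t2 \<Longrightarrow> acc (T w t1 t2)"
begin

section \<open>Survival sets and domination of the initial state by itself\<close>

lemma D_in_Q: "t \<in> D \<Longrightarrow> src t \<in> Q \<and> lbl t \<in> Sg \<and> tgt t \<in> Q"
  using D_Q by (cases t) auto

text \<open>These are the states from which any \<open>n\<close> letters, given one by one, can be
  answered; the automaton may have dead ends. The decreasing sets stabilise at the states where Eve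
  never has to get stuck.\<close>

primrec al :: "nat \<Rightarrow> 's set" where
  "al 0 = Q"
| "al (Suc n) = {p \<in> Q. \<forall>a\<in>Sg. \<exists>p'\<in>al n. (p, a, p') \<in> D}"

lemma al_Suc: "al (Suc n) \<subseteq> al n"
proof (induction n)
  case (Suc n)
  show ?case
  proof
    fix p assume "p \<in> al (Suc (Suc n))"
    then have "p \<in> Q" "\<forall>a\<in>Sg. \<exists>p'\<in>al (Suc n). (p, a, p') \<in> D"
      unfolding al.simps(2)[of "Suc n"] by blast+
    then show "p \<in> al (Suc n)" using Suc unfolding al.simps(2)[of n] by blast
  qed
qed auto

lemma al_Q: "al n \<subseteq> Q"
  by (cases n) auto

lemma al_stable: "\<exists>N. al (Suc N) = al N"
proof -
  obtain N where "\<And>n. card (al N) \<le> card (al n)"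
    using ex_has_least_nat[of "\<lambda>_. True" 0 "\<lambda>n. card (al n)"] by blast
  then have "al (Suc N) = al N"
    using card_seteq[OF finite_subset[OF al_Q finite_Q] al_Suc] by blast
  then show ?thesis ..
qed

text \<open>Both tokens of a link copy the previous link, so the two-token strategy plays against
  one token, and each link adds delay 1.\<close>

primrec chain :: "nat \<Rightarrow> (nat \<Rightarrow> 'a) \<Rightarrow> (nat \<Rightarrow> ('s,'a) trans) \<Rightarrow> nat \<Rightarrow> ('s,'a) trans" where
  "chain 0 w t = t"
| "chain (Suc N) w t = T w (chain N w t) (chain N w t)"

lemma chain_delayed: "delayed N (chain N)"
proof (induction N)
  case 0
  then show ?case by (simp add: delayed_def)
next
  case (Suc N)
  have "delayed 1 (\<lambda>w t. T w t t)" unfolding delayed_def by (auto intro!: T_causal)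
  from delayed_compose[OF this Suc] show ?case by simp
qed

lemma chain_legal: "wordin Sg w \<Longrightarrow> runp D q0 w t n \<Longrightarrow> runp D q0 w (chain N w t) (n + N)"
  by (induction N) (auto intro: T_legal)

lemma chain_acc:
  assumes "wordin Sg w" "runf D q0 w t" "acc t"
  shows "acc (chain N w t)"
proof (induction N)
  case (Suc N)
  have "runf D q0 w (chain N w t)"
    using chain_legal[OF assms(1)] assms(2) runp_mono unfolding runf_iff by (metis le_add1)
  then show ?case using T_win assms(1) Suc by simp
qed (simp add: assms)

text \<open>Each link of the chain survives one letter more than the token it plays against.\<close>
lemma chain_alive:
  "k + j = M \<Longrightarrow> wordin Sg w \<Longrightarrow> runp D q0 w t n \<Longrightarrow> st q0 (chain M w t) (n + k) \<in> al j"
proof (induction j arbitrary: k w)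
  case 0
  have "runp D q0 w (chain M w t) (n + M)" using chain_legal 0 by blast
  then show ?case using 0 q0 D_in_Q by (cases "n + k") (auto simp: runp_Suc)
next
  case (Suc j)
  have r: "runp D q0 w (chain M w t) (n + M)" using chain_legal Suc.prems by blast
  have "runp D q0 w (chain M w t) (n + k)" by (rule runp_mono[OF r]) (use Suc.prems in simp)
  then have "st q0 (chain M w t) (n + k) \<in> Q"
    using q0 D_in_Q by (cases "n + k") (auto simp: runp_Suc)
  moreover have "\<exists>p'\<in>al j. (st q0 (chain M w t) (n + k), a, p') \<in> D" if a: "a \<in> Sg" for a
  proof -
    define v where "v = w(n + k := a)"
    have v: "wordin Sg v" using Suc.prems a by (auto simp: v_def wordin_def)
    have "runp D q0 v t n \<longleftrightarrow> runp D q0 w t n" by (rule runp_cong) (auto simp: v_def)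
    then have t: "runp D q0 v t n" using Suc.prems by simp
    have "runp D q0 v (chain M v t) (Suc (n + k))"
      by (rule runp_mono[OF chain_legal[OF v t, of M]]) (use Suc.prems in simp)
    then have e: "chain M v t (n + k) \<in> D" "lbl (chain M v t (n + k)) = a"
      "src (chain M v t (n + k)) = st q0 (chain M v t) (n + k)" by (auto simp: runp_Suc v_def)
    have "st q0 (chain M v t) (n + k) = st q0 (chain M w t) (n + k)"
      by (rule st_cong, rule delayedD[OF chain_delayed]) (auto simp: v_def)
    then have "(st q0 (chain M w t) (n + k), a, tgt (chain M v t (n + k))) \<in> D"
      using e by (metis trans_collapse)
    moreover have "tgt (chain M v t (n + k)) \<in> al j"
      using Suc.IH[of "Suc k" v] Suc.prems v t by simp
    ultimately show ?thesis by blast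
  qed
  ultimately show ?case by simp
qed

text \<open>Eve has to continue even when Adam's token gets stuck, so she needs to remain in the
  stable set \<open>al N\<close>. A chain of \<open>Suc N\<close> links is in \<open>al N\<close>
  one step ahead of the token, and \<open>repair\<close> does the rest.\<close>

lemma dom_init: "dom q0 q0"
proof -
  obtain N where N: "al (Suc N) = al N" using al_stable by blast
  have tot: "\<exists>t\<in>D. src t = p \<and> lbl t = a \<and> tgt t \<in> al N" if p: "p \<in> al N" and a: "a \<in> Sg" for p a
  proof -
    have "p \<in> al (Suc N)" using N p by simp
    then obtain p' where "p' \<in> al N" "(p, a, p') \<in> D" using a by auto
    then show ?thesis by (intro bexI[of _ "(p, a, p')"]) auto
  qed
  have leg: "runp D q0 w (chain (Suc N) w t) (Suc n) \<and> st q0 (chain (Suc N) w t) (Suc n) \<in> al N"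
    if "wordin Sg w" "runp D q0 w t n" for w t n
    using runp_mono[OF chain_legal[OF that, of "Suc N"], of "Suc n"] chain_alive[OF _ that, of 1 N "Suc N"] by simp
  have dc: "delayed 1 (chain (Suc N))" by (rule delayed_mono[OF chain_delayed]) simp
  obtain F where F: "delayed 1 F"
    "\<And>w t. wordin Sg w \<Longrightarrow> runf D q0 w (F w t)" "\<And>w t. wordin Sg w \<Longrightarrow> runf D q0 w t \<Longrightarrow> F w t = chain (Suc N) w t"
    using repair[where Sg = Sg and D = D and D' = D and q = q0, OF tot dc leg] by blast
  have "wins F q0 q0" unfolding wins_def using F chain_acc[of _ _ "Suc N"] by (auto simp del: chain.simps)
  then show ?thesis by (auto simp: dom_def)
qed

section \<open>Dominating states and the arena of pairs\<close>

definition good :: "'s set \<Rightarrow> 's \<Rightarrow> bool" where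
  "good S p \<longleftrightarrow> S \<subseteq> Q \<and> p \<in> S \<and> (\<forall>q\<in>S. dom p q)"

definition sc :: "'s set \<Rightarrow> 'a \<Rightarrow> 's set" where
  "sc S a = {q'. \<exists>q\<in>S. (q, a, q') \<in> D}"

lemma sc_Q: "sc S a \<subseteq> Q"
  unfolding sc_def using D_Q by auto

text \<open>As \<open>p\<close> dominates itself, some \<open>p'\<close> dominates all
  \<open>a\<close>-successors of \<open>p\<close>. Every state of \<open>sc S a\<close> is dominated
  by one of these, hence by \<open>p'\<close>.\<close>

lemma good_step:
  assumes g: "good S p" and a: "a \<in> Sg"
  shows "\<exists>p'. (p, a, p') \<in> D \<and> good (sc S a) p'"
proof -
  have pS: "p \<in> S" "dom p p" using g by (auto simp: good_def)
  obtain p' where p': "(p, a, p') \<in> D" "\<And>q'. (p, a, q') \<in> D \<Longrightarrow> dom p' q'"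
    using dom_step[OF pS(2) a] by blast
  have "dom p' q'" if q': "q' \<in> sc S a" for q'
  proof -
    obtain q where q: "q \<in> S" "(q, a, q') \<in> D" using q' by (auto simp: sc_def)
    have "dom p q" using g q by (auto simp: good_def)
    then obtain p'' where "(p, a, p'') \<in> D" "dom p'' q'" using dom_step[OF _ a] q by blast
    then show ?thesis using p'(2) dom_trans by blast
  qed
  then show ?thesis using p'(1) pS sc_Q unfolding good_def by (auto simp: sc_def)
qed

lemma good_dom: "good S z \<Longrightarrow> p \<in> S \<Longrightarrow> dom p z \<Longrightarrow> good S p"
  unfolding good_def using dom_trans by blast

text \<open>An arena state pairs a state with a set that contains it and is dominated by it; the set
  follows the subset construction. With \<open>snd\<close> as class, states of one class dominate
  each other.\<close>

definition V :: "('s \<times> 's set) set" where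
  "V = {v. good (snd v) (fst v)}"

definition pr :: "('s \<times> 's set, 'a) trans \<Rightarrow> ('s,'a) trans" where
  "pr t = (fst (src t), lbl t, fst (tgt t))"

definition E :: "('s \<times> 's set, 'a) trans set" where
  "E = {t. pr t \<in> D \<and> src t \<in> V \<and> tgt t \<in> V \<and> snd (tgt t) = sc (snd (src t)) (lbl t)}"

abbreviation acc' :: "(nat \<Rightarrow> ('s \<times> 's set, 'a) trans) \<Rightarrow> bool" where
  "acc' r \<equiv> acc (\<lambda>i. pr (r i))"

primrec Sn :: "'s set \<Rightarrow> (nat \<Rightarrow> 'a) \<Rightarrow> nat \<Rightarrow> 's set" where
  "Sn S w 0 = S"
| "Sn S w (Suc i) = sc (Sn S w i) (w i)"

definition lift :: "'s set \<Rightarrow> (nat \<Rightarrow> 'a) \<Rightarrow> (nat \<Rightarrow> ('s,'a) trans) \<Rightarrow> nat \<Rightarrow> ('s \<times> 's set, 'a) trans" where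
  "lift S w f i = ((src (f i), Sn S w i), lbl (f i), (tgt (f i), Sn S w (Suc i)))"

lemma pr_simps [simp]: "lbl (pr t) = lbl t" "src (pr t) = fst (src t)" "tgt (pr t) = fst (tgt t)"
  by (auto simp: pr_def)

lemma pr_lift [simp]: "pr (lift S w f i) = f i"
  by (simp add: pr_def lift_def)

lemma Sn_cong: "(\<And>j. j < i \<Longrightarrow> w j = w' j) \<Longrightarrow> Sn S w i = Sn S w' i"
  by (induction i) auto

lemma st_pr: "st (fst v) (\<lambda>i. pr (t i)) n = fst (st v t n)"
  by (cases n) auto

lemma runp_pr:
  assumes "runp E v w t n"
  shows "runp D (fst v) w (\<lambda>i. pr (t i)) n"
  using assms unfolding runp_def st_pr by (auto simp: E_def)

lemma runf_pr: "runf E v w t \<Longrightarrow> runf D (fst v) w (\<lambda>i. pr (t i))"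
  unfolding runf_iff using runp_pr by blast

lemma runp_Sn: "runp E v w t n \<Longrightarrow> i \<le> n \<Longrightarrow> snd (st v t i) = Sn (snd v) w i"
proof (induction i)
  case (Suc i)
  then have "t i \<in> E" "lbl (t i) = w i" "src (t i) = st v t i" by (auto simp: runp_def)
  then show ?case using Suc by (simp add: E_def)
qed simp

lemma runp_E_V: "runp E v w t n \<Longrightarrow> v \<in> V \<Longrightarrow> i \<le> n \<Longrightarrow> st v t i \<in> V"
  by (cases i) (auto simp: runp_def E_def)

lemma runp_in_Sn: "runp D p w f n \<Longrightarrow> p \<in> S \<Longrightarrow> i \<le> n \<Longrightarrow> st p f i \<in> Sn S w i"
proof (induction i)
  case (Suc i)
  then have "f i \<in> D" "lbl (f i) = w i" "src (f i) \<in> Sn S w i" by (auto simp: runp_def)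
  then have "(src (f i), w i, tgt (f i)) \<in> D" by (metis trans_collapse)
  then show ?case using \<open>src (f i) \<in> Sn S w i\<close> by (auto simp: sc_def)
qed simp

lemma st_lift: "st (p, S) (lift S w f) n = (st p f n, Sn S w n)"
  by (cases n) (auto simp: lift_def)

lemma runp_lift:
  assumes f: "runp D p w f n" and g: "\<And>i. i \<le> n \<Longrightarrow> good (Sn S w i) (st p f i)"
  shows "runp E (p, S) w (lift S w f) n"
  unfolding runp_def
proof (intro allI impI)
  fix i assume i: "i < n"
  then have fi: "f i \<in> D" "lbl (f i) = w i" "src (f i) = st p f i" using f by (auto simp: runp_def)
  have "good (Sn S w i) (src (f i))" "good (Sn S w (Suc i)) (tgt (f i))"
    using g[of i] g[of "Suc i"] fi i by auto
  then have "lift S w f i \<in> E" using fi unfolding E_def by (auto simp: V_def) (auto simp: lift_def)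
  then show "lift S w f i \<in> E \<and> lbl (lift S w f i) = w i \<and> src (lift S w f i) = st (p, S) (lift S w f) i"
    using fi unfolding st_lift by (simp add: lift_def)
qed

lemma E_total:
  assumes "v \<in> V" "a \<in> Sg"
  shows "\<exists>t\<in>E. src t = v \<and> lbl t = a \<and> tgt t \<in> V"
proof -
  obtain p' where "(fst v, a, p') \<in> D" "good (sc (snd v) a) p'" using good_step[of "snd v" "fst v" a] assms by (auto simp: V_def)
  then show ?thesis using assms by (intro bexI[of _ "(v, a, (p', sc (snd v) a))"]) (auto simp: E_def V_def pr_def)
qed

lemma game': "game acc'"
proof
  fix r :: "nat \<Rightarrow> ('s \<times> 's set, 'a) trans" and n
  show "acc (\<lambda>i. pr (r (n + i))) \<longleftrightarrow> acc (\<lambda>i. pr (r i))" using acc_shift[of "\<lambda>i. pr (r i)" n] .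
qed

text \<open>Eve's state dominates the token's good state and lies in the same set, so it is good as
  well and her run stays in the arena.\<close>

lemma lift_legal:
  assumes F: "wins F p q" and pq: "(p, S) \<in> V" "(q, S) \<in> V" and w: "wordin Sg w"
    and t: "runp E (q, S) w t n"
  shows "runp E (p, S) w (lift S w (F w (\<lambda>i. pr (t i)))) (Suc n)"
    "st (p, S) (lift S w (F w (\<lambda>i. pr (t i)))) (Suc n) \<in> V"
proof -
  let ?t = "\<lambda>i. pr (t i)"
  have tp: "runp D q w ?t n" using runp_pr[OF t] by simp
  have dF: "delayed 1 F" using F by (simp add: wins_def)
  have gs: "good (Sn S w i) (st q ?t i)" if "i \<le> n" for i
    using runp_E_V[OF t pq(2) that] runp_Sn[OF t that] st_pr[of "(q, S)" t i] by (simp add: V_def)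
  obtain q' where q': "(st q ?t n, w n, q') \<in> D" "good (Sn S w (Suc n)) q'"
    using good_step[OF gs[of n]] w by (auto simp: wordin_def)
  \<comment> \<open>The token is one step behind Eve and is extended by a step to a good state. By
    delay 1, Eve's first \<open>Suc n\<close> moves do not see this extension.\<close>
  define u where "u = ?t(n := (st q ?t n, w n, q'))"
  have su: "st q u i = st q ?t i" if "i \<le> n" for i
    by (rule st_cong) (use that in \<open>auto simp: u_def\<close>)
  have "runp D q w u n \<longleftrightarrow> runp D q w ?t n" by (rule runp_cong) (auto simp: u_def)
  then have u: "runp D q w u (Suc n)" using tp q'(1) su[of n] by (simp add: runp_Suc u_def)
  have gu: "good (Sn S w i) (st q u i)" if "i \<le> Suc n" for i
    using that gs[of i] su[of i] q'(2) by (cases "i = Suc n") (auto simp: u_def)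
  have Fu: "F w u i = F w ?t i" if "i < Suc n" for i
    by (rule delayedD[OF dF]) (use that in \<open>auto simp: u_def\<close>)
  have r: "runp D p w (F w ?t) (Suc n)" using F w by (auto simp: wins_def runf_iff)
  have pS: "p \<in> S" using pq by (auto simp: V_def good_def)
  have g: "good (Sn S w i) (st p (F w ?t) i)" if i: "i \<le> Suc n" for i
  proof (rule good_dom[OF gu[OF i]])
    show "st p (F w ?t) i \<in> Sn S w i" by (rule runp_in_Sn[OF r pS i])
    have "st p (F w u) i = st p (F w ?t) i" by (rule st_cong, rule Fu) (use i in auto)
    then show "dom (st p (F w ?t) i) (st q u i)" using wins_residual[OF F w runp_mono[OF u i]] by simp
  qed
  show "runp E (p, S) w (lift S w (F w ?t)) (Suc n)" by (rule runp_lift[OF r g])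
  show "st (p, S) (lift S w (F w ?t)) (Suc n) \<in> V"
    using g[of "Suc n"] unfolding st_lift V_def by simp
qed

text \<open>The strategy on the projections is lifted to pairs. The lift is legal against legal
  tokens, and \<open>repair\<close> covers the others.\<close>

lemma dom':
  assumes "v \<in> V" "v' \<in> V" "snd v = snd v'"
  shows "game.dom E Sg acc' v v'"
proof -
  interpret g: game E Sg acc' by (rule game')
  obtain p q S where v: "v = (p, S)" "v' = (q, S)" using assms by (cases v; cases v') auto
  have "dom p q" using assms unfolding v V_def good_def by auto
  then obtain F where F: "wins F p q" by (auto simp: dom_def)
  have dF: "delayed 1 F" using F by (simp add: wins_def)
  define G where "G w t = lift S w (F w (\<lambda>i. pr (t i)))" for w t
  have dG: "delayed 1 G" unfolding delayed_def
  proof (intro allI impI)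
    fix w w' :: "nat \<Rightarrow> 'a" and t t' :: "nat \<Rightarrow> ('s \<times> 's set, 'a) trans" and i
    assume a: "\<forall>j\<le>i. w j = w' j" "\<forall>j. j + 1 \<le> i \<longrightarrow> t j = t' j"
    have "F w (\<lambda>i. pr (t i)) i = F w' (\<lambda>i. pr (t' i)) i" by (rule delayedD[OF dF]) (use a in auto)
    moreover have "Sn S w i = Sn S w' i" by (rule Sn_cong) (use a in auto)
    moreover have "w i = w' i" using a by simp
    ultimately show "G w t i = G w' t' i" by (simp add: G_def lift_def)
  qed
  have leg: "runp E (p, S) w (G w t) (Suc n) \<and> st (p, S) (G w t) (Suc n) \<in> V"
    if "wordin Sg w" "runp E (q, S) w t n" for w t n
    unfolding G_def using lift_legal[OF F _ _ that] assms v by blast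
  obtain H where H: "delayed 1 H" "\<And>w t. wordin Sg w \<Longrightarrow> runf E (p, S) w (H w t)"
    "\<And>w t. wordin Sg w \<Longrightarrow> runf E (q, S) w t \<Longrightarrow> H w t = G w t"
    using repair[where Sg = Sg and D = E and D' = E and q = "(q, S)", OF E_total dG leg] by blast
  have "acc' (H w t)" if w: "wordin Sg w" and t: "runf E (q, S) w t" "acc' t" for w t
  proof -
    have "runf D q w (\<lambda>i. pr (t i))" using runf_pr[OF t(1)] by simp
    then have "acc (F w (\<lambda>i. pr (t i)))" using F w t(2) by (auto simp: wins_def)
    then show ?thesis unfolding H(3)[OF w t(1)] G_def pr_lift by simp
  qed
  then have "g.wins H (p, S) (q, S)" unfolding g.wins_def using H by blast
  then show ?thesis unfolding g.dom_def v by blast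
qed

lemma arena': "arena E Sg acc' V snd"
proof -
  interpret g: game E Sg acc' by (rule game')
  show ?thesis
  proof
    have "V \<subseteq> Q \<times> Pow Q" by (auto simp: V_def good_def)
    then show "finite V" using finite_Q by (meson finite_Pow_iff finite_SigmaI finite_subset)
    show "finite Sg" by (rule finite_Sg)
    show "E \<subseteq> V \<times> Sg \<times> V"
    proof
      fix t assume t: "t \<in> E"
      then have "lbl t \<in> Sg" using D_in_Q[of "pr t"] by (simp add: E_def)
      then show "t \<in> V \<times> Sg \<times> V" using t by (cases t) (auto simp: E_def)
    qed
    show "\<exists>p'. (p, a, p') \<in> E" if "p \<in> V" "a \<in> Sg" for p a
      using E_total[OF that] by (metis trans_collapse)
    show "snd p' = snd q'" if "(p, a, p') \<in> E" "(q, a, q') \<in> E" "snd p = snd q" for p a p' q q'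
      using that by (auto simp: E_def)
    show "g.dom p q" if "p \<in> V" "q \<in> V" "snd p = snd q" for p q
      by (rule dom'[OF that])
  qed
qed

lemma v0: "(q0, {q0}) \<in> V"
  using dom_init q0 by (auto simp: V_def good_def)

text \<open>Eve plays the two-token strategy against two tokens: one chases \<open>r\<close>, which
  makes her run accepting, the other chases the arena run \<open>z\<close>, so that her states
  dominate those of \<open>z\<close> and are good.\<close>

lemma accepted_in_arena:
  assumes w: "wordin Sg w" and r: "runf D q0 w r" "acc r"
  shows "\<exists>r'. runf E (q0, {q0}) w r' \<and> acc' r'"
proof -
  interpret a: arena E Sg acc' V snd by (rule arena')
  obtain z where z: "runf E (q0, {q0}) w z" using a.default_run[OF v0] w by blast
  obtain F where F: "wins F q0 q0" using dom_init by (auto simp: dom_def)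
  have dF: "delayed 1 F" using F by (simp add: wins_def)
  have Fr: "runf D q0 v (F v t)" if "wordin Sg v" for v t using F that by (auto simp: wins_def)
  have Fa: "acc (F v t)" if "wordin Sg v" "runf D q0 v t" "acc t" for v t using F that by (auto simp: wins_def)
  \<comment> \<open>\<open>r\<close> is a run on \<open>w\<close> alone, whereas
    \<open>F v r\<close> is a run on every \<open>v\<close>; hence \<open>H\<close> is a winning
    one-token strategy.\<close>
  define H where "H v t = T v (F v r) (F v t)" for v t
  have "delayed 1 H" unfolding delayed_def H_def
  proof (intro allI impI)
    fix w w' :: "nat \<Rightarrow> 'a" and t t' :: "nat \<Rightarrow> ('s,'a) trans" and i
    assume a: "\<forall>j\<le>i. w j = w' j" "\<forall>j. j + 1 \<le> i \<longrightarrow> t j = t' j"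
    have "F w r j = F w' r j" "F w t j = F w' t' j" if "j < i" for j
      by (rule delayedD[OF dF], use a that in auto)+
    then show "T w (F w r) (F w t) i = T w' (F w' r) (F w' t') i"
      using a by (intro T_causal) auto
  qed
  moreover have Hr: "runf D q0 v (H v t)" if "wordin Sg v" for v t
  proof -
    have "runp D q0 v (H v t) (Suc n)" for n
      unfolding H_def using T_legal[OF that, of "F v r" n "F v t"] Fr[OF that] by (simp add: runf_iff)
    then show ?thesis unfolding runf_iff using runp_mono by (metis le_Suc_eq order_refl)
  qed
  moreover have "acc (H v t)" if "wordin Sg v" "runf D q0 v t" "acc t" for v t
    unfolding H_def using T_win[OF that(1) Fr[OF that(1)] Fr[OF that(1)]] Fa[OF that] by blast
  ultimately have H: "wins H q0 q0" by (auto simp: wins_def)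
  define f where "f = H w (\<lambda>i. pr (z i))"
  have zp: "runf D q0 w (\<lambda>i. pr (z i))" using runf_pr[OF z] by simp
  have fr: "runf D q0 w f" unfolding f_def using Hr w by blast
  have g: "good (Sn {q0} w n) (st q0 f n)" for n
  proof (rule good_dom)
    have zn: "runp E (q0, {q0}) w z n" using z by (simp add: runf_iff)
    show "good (Sn {q0} w n) (st q0 (\<lambda>i. pr (z i)) n)"
      using runp_E_V[OF zn v0, of n] runp_Sn[OF zn, of n] st_pr[of "(q0, {q0})" z n] by (simp add: V_def)
    show "st q0 f n \<in> Sn {q0} w n" using fr by (intro runp_in_Sn[of _ _ _ n]) (auto simp: runf_iff)
    show "dom (st q0 f n) (st q0 (\<lambda>i. pr (z i)) n)"
      unfolding f_def using zp by (intro wins_residual[OF H w]) (simp add: runf_iff)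
  qed
  have "runf E (q0, {q0}) w (lift {q0} w f)"
    unfolding runf_iff using fr g by (intro allI runp_lift) (auto simp: runf_iff)
  moreover have "acc f" unfolding f_def H_def
    using T_win[OF w Fr[OF w] Fr[OF w]] Fa[OF w r] by blast
  ultimately show ?thesis by (intro exI[of _ "lift {q0} w f"]) simp
qed

text \<open>The arena resolver is projected; by \<open>accepted_in_arena\<close> every accepted word
  is also accepted in the arena.\<close>

lemma resolver_of_arena:
  assumes "arena.resolvable E Sg acc' (q0, {q0})"
  shows "\<exists>R. wcausal R \<and> (\<forall>w. wordin Sg w \<longrightarrow> runf D q0 w (R w) \<and>
     ((\<exists>r. runf D q0 w r \<and> acc r) \<longrightarrow> acc (R w)))"
proof -
  interpret a: arena E Sg acc' V snd by (rule arena')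
  obtain R where R: "wcausal R" "\<And>w. wordin Sg w \<Longrightarrow> runf E (q0, {q0}) w (R w)"
    "\<And>w r. wordin Sg w \<Longrightarrow> runf E (q0, {q0}) w r \<Longrightarrow> acc' r \<Longrightarrow> acc' (R w)"
    using assms unfolding a.resolvable_def by blast
  have "wcausal (\<lambda>w i. pr (R w i))" using R(1) unfolding wcausal_def by metis
  moreover have "runf D q0 w (\<lambda>i. pr (R w i))" if "wordin Sg w" for w
    using runf_pr[OF R(2)[OF that]] by simp
  ultimately show ?thesis using R(3) accepted_in_arena
    by (intro exI[of _ "\<lambda>w i. pr (R w i)"]) blast
qed

end

section \<open>History-determinism and the two-token game\<close>

lemma frequently_shift: "(\<exists>\<^sub>\<infinity>i. P (n + i)) \<longleftrightarrow> (\<exists>\<^sub>\<infinity>i::nat. P i)"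
  unfolding INFM_nat_le
proof safe
  fix m assume "\<forall>m. \<exists>i\<ge>m. P (n + i)"
  then obtain i where "i \<ge> m" "P (n + i)" by blast
  then show "\<exists>i\<ge>m. P i" by (intro exI[of _ "n + i"]) auto
next
  fix m assume "\<forall>m. \<exists>i\<ge>m. P i"
  then obtain i where "i \<ge> n + m" "P i" by blast
  then show "\<exists>i\<ge>m. P (n + i)" by (intro exI[of _ "i - n"]) auto
qed

lemma gen_buchi_shift: "gen_buchi C (\<lambda>i. x (n + i)) \<longleftrightarrow> gen_buchi C x"
  unfolding gen_buchi_def using frequently_shift[of "\<lambda>i. c \<in> x i" n for c] by simp

lemma gen_cobuchi_shift: "gen_cobuchi C (\<lambda>i. x (n + i)) \<longleftrightarrow> gen_cobuchi C x"
  unfolding gen_cobuchi_def using frequently_shift[of "\<lambda>i. c \<in> x i" n for c]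
  unfolding INFM_iff_infinite by blast

lemma run_prefix_runp: "run_prefix A w r n \<longleftrightarrow> runp (delta A) (init A) w r n"
  by (simp add: run_prefix_def runp_def st_def)

lemma is_run_runf: "is_run A w r \<longleftrightarrow> runf (delta A) (init A) w r"
  by (simp add: is_run_def run_prefix_runp runf_iff)

lemma is_word_wordin: "is_word A w \<longleftrightarrow> wordin (alphabet A) w"
  by (simp add: is_word_def wordin_def)

lemma history_deterministic_of_causal:
  assumes "alphabet A \<noteq> {}" and R: "wcausal R"
    and run: "\<And>w. is_word A w \<Longrightarrow> is_run A w (R w)"
    and acc: "\<And>w. is_word A w \<Longrightarrow> w \<in> lang A W \<Longrightarrow> accepting A W (R w)"
  shows "history_deterministic A W"
proof -
  obtain a where "a \<in> alphabet A" using assms by blast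
  \<comment> \<open>The letter \<open>a\<close> only pads the word; for nonempty \<open>u\<close>,
    the causal \<open>R\<close> at position \<open>length u - 1\<close> does not read it.\<close>
  define \<sigma> where "\<sigma> u = R (\<lambda>j. if j < length u then u ! j else a) (length u - 1)" for u
  have "(\<lambda>i. \<sigma> (pref w (Suc i))) = R w" for w
  proof
    fix i
    have "length (pref w (Suc i)) = Suc i" "\<And>j. j \<le> i \<Longrightarrow> pref w (Suc i) ! j = w j"
      by (simp_all add: pref_def del: upt_Suc)
    then show "\<sigma> (pref w (Suc i)) = R w i"
      unfolding \<sigma>_def by (simp, intro wcausalD[OF R]) simp
  qed
  then have "is_resolver A W \<sigma>" unfolding is_resolver_def using run acc by simp
  then show ?thesis unfolding history_deterministic_def by blast
qed

lemma history_deterministic_imp_eve_wins_G2: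
  assumes "history_deterministic A W"
  shows "eve_wins_G2 A W"
proof -
  obtain \<sigma> where \<sigma>: "is_resolver A W \<sigma>" using assms by (auto simp: history_deterministic_def)
  define \<tau> where "\<tau> u v = \<sigma> u" for u and v :: "(('a,'b) trans \<times> ('a,'b) trans) list"
  have play: "eve_play \<tau> w t1 t2 = (\<lambda>i. \<sigma> (pref w (Suc i)))" for w t1 t2
    by (simp add: eve_play_def \<tau>_def fun_eq_iff)
  have run: "is_run A w (\<lambda>i. \<sigma> (pref w (Suc i)))" if "is_word A w" for w
    using \<sigma> that by (simp add: is_resolver_def)
  show ?thesis unfolding eve_wins_G2_def
  proof (intro exI[of _ \<tau>] conjI allI impI)
    fix w t1 t2 n assume "is_word A w"
    then show "run_prefix A w (eve_play \<tau> w t1 t2) (Suc n)"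
      unfolding play using run by (simp only: is_run_def)
  next
    fix w t1 t2 assume w: "is_word A w" and t: "is_run A w t1" "is_run A w t2"
    show "accepting A W (eve_play \<tau> w t1 t2) \<or> \<not> accepting A W t1 \<and> \<not> accepting A W t2"
    proof (cases "accepting A W t1 \<or> accepting A W t2")
      case True
      then have "w \<in> lang A W" using w t by (auto simp: lang_def)
      then show ?thesis unfolding play using \<sigma> w by (simp add: is_resolver_def)
    qed simp
  qed
qed

lemma eve_wins_G2_imp_history_deterministic:
  assumes wf: "wf_automaton A" and W: "W = gen_buchi (colours A) \<or> W = gen_cobuchi (colours A)"
    and G2: "eve_wins_G2 A W"
  shows "history_deterministic A W"
proof (cases "alphabet A = {}")
  case True
  \<comment> \<open>Without letters there is no infinite word, so every map is a resolver.\<close>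
  then have "is_resolver A W \<sigma>" for \<sigma> by (simp add: is_resolver_def is_word_def)
  then show ?thesis by (auto simp: history_deterministic_def)
next
  case ne: False
  obtain \<tau> where leg: "\<And>w t1 t2 n. is_word A w \<Longrightarrow> run_prefix A w t1 n \<Longrightarrow> run_prefix A w t2 n \<Longrightarrow>
        run_prefix A w (eve_play \<tau> w t1 t2) (Suc n)"
    and win: "\<And>w t1 t2. is_word A w \<Longrightarrow> is_run A w t1 \<Longrightarrow> is_run A w t2 \<Longrightarrow>
        accepting A W (eve_play \<tau> w t1 t2) \<or> (\<not> accepting A W t1 \<and> \<not> accepting A W t2)"
    using G2 unfolding eve_wins_G2_def by blast
  interpret two_token "delta A" "alphabet A" "accepting A W" "states A" "init A" "eve_play \<tau>"
  proof
    show "accepting A W (\<lambda>i. r (n + i)) = accepting A W r" for r n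
      using W gen_buchi_shift[of "colours A" "\<lambda>i. col A (r i)" n]
        gen_cobuchi_shift[of "colours A" "\<lambda>i. col A (r i)" n] by (auto simp: accepting_def)
    show "finite (states A)" "finite (alphabet A)" "init A \<in> states A"
      "delta A \<subseteq> states A \<times> alphabet A \<times> states A" using wf by (auto simp: wf_automaton_def)
    show "eve_play \<tau> w t1 t2 i = eve_play \<tau> w' t1' t2' i"
      if "\<And>j. j \<le> i \<Longrightarrow> w j = w' j" "\<And>j. j < i \<Longrightarrow> t1 j = t1' j" "\<And>j. j < i \<Longrightarrow> t2 j = t2' j"
      for i w w' t1 t1' t2 t2'
    proof -
      have "pref w (Suc i) = pref w' (Suc i)" unfolding pref_def using that(1) by (intro map_cong) auto
      moreover have "map (\<lambda>j. (t1 j, t2 j)) [0..<i] = map (\<lambda>j. (t1' j, t2' j)) [0..<i]" using that(2,3) by auto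
      ultimately show ?thesis by (simp only: eve_play_def)
    qed
    show "runp (delta A) (init A) w (eve_play \<tau> w t1 t2) (Suc n)"
      if "wordin (alphabet A) w" "runp (delta A) (init A) w t1 n" "runp (delta A) (init A) w t2 n" for w t1 n t2
      using leg that unfolding is_word_wordin run_prefix_runp by blast
    show "accepting A W (eve_play \<tau> w t1 t2)"
      if "wordin (alphabet A) w" "runf (delta A) (init A) w t1" "runf (delta A) (init A) w t2"
        "accepting A W t1 \<or> accepting A W t2" for w t1 t2
      using win that unfolding is_word_wordin is_run_runf by blast
  qed
  have finC: "finite (colours A)" using wf by (simp add: wf_automaton_def)
  have "arena.resolvable E (alphabet A) acc' (init A, {init A})"
    using W
  proof
    assume W: "W = gen_buchi (colours A)"
    interpret b: buchi_arena E "alphabet A" acc' V snd "\<lambda>t. col A (pr t)" "colours A"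
      by (intro buchi_arena.intro arena' buchi_arena_axioms.intro) (auto simp: accepting_def W finC)
    show ?thesis by (rule b.buchi_resolvable[OF v0 ne])
  next
    assume W: "W = gen_cobuchi (colours A)"
    interpret c: cobuchi_arena E "alphabet A" acc' V snd "\<lambda>t. col A (pr t)" "colours A"
      by (intro cobuchi_arena.intro arena' cobuchi_arena_axioms.intro) (auto simp: accepting_def W finC)
    show ?thesis by (rule c.cobuchi_resolvable[OF v0 ne])
  qed
  from resolver_of_arena[OF this] obtain R where R: "wcausal R"
    "\<And>w. is_word A w \<Longrightarrow> is_run A w (R w)"
    "\<And>w r. is_word A w \<Longrightarrow> is_run A w r \<Longrightarrow> accepting A W r \<Longrightarrow> accepting A W (R w)"
    unfolding is_word_wordin is_run_runf by blast
  show ?thesis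
    by (rule history_deterministic_of_causal[OF ne R(1,2)]) (use R(3) in \<open>auto simp: lang_def\<close>)
qed

theorem theorem37:
  fixes A :: "('q,'a,'c) automaton" and W :: "(nat \<Rightarrow> 'c set) \<Rightarrow> bool"
  assumes "wf_automaton A"
    and "W = gen_buchi (colours A) \<or> W = gen_cobuchi (colours A)"
  shows "history_deterministic A W \<longleftrightarrow> eve_wins_G2 A W"
  using history_deterministic_imp_eve_wins_G2 eve_wins_G2_imp_history_deterministic[OF assms] by blast

end
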